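(* Let $V=\{1,\dots,n\}$, $n\ge 2$, be a set of agents and let $d\ge 1$. Consider the PaWBar algorithm with an underlying graph $G$ which is either (i) a cycle graph for the directed PaWBar algorithm, or (ii) a line graph for the symmetric PaWBar algorithm; and with the agents having arbitrary initial measures $\mu_{i,0}\in\mathcal{P}^2(\mathbb{R}^d)$, $i\in V$. Then, with probability one, for any $i\in V$, $$W_2(\mu_i(t),\mu_\infty)\to 0\quad\text{as }t\to\infty,$$ where $\mu_\infty\in\mathcal{P}^2(\mathbb{R}^d)$ is a random measure whose possible values may depend on the realization of the edge selection process. If $\mu_{i,0}=\mu_{j,0}$ for any $i,j\in V$, then $\mu_\infty=\mu_{i,0}$ with probability one.
   Context: Notation. $\mathcal{P}^2(\mathbb{R}^d)$ is the set of Borel probability measures on $\mathbb{R}^d$ with finite second moment, and $W_2$ is the 2-Wasserstein distance for the Euclidean norm. For $\mu,\nu\in\mathcal{P}^2(\mathbb{R}^d)$, $\gamma^{\mathrm{opt}}(\mu,\nu)$ denotes an optimal transport plan between $\mu$ and $\nu$, i.e. a minimizer of $\int\|x-y\|_2^2\,d\gamma(x,y)$ over couplings of $\mu$ and $\nu$. For $a\in[0,1]$, $\pi_a(x,y)=(1-a)x+ay$, and $\#$ denotes push-forward. Graphs. A digraph on $V$ is a cycle graph if its nodes can be labeled so that its edge set is $\{(1,2),\dots,(n-1,n),(n,1)\}$. An undirected graph on $V$ is a line graph if its nodes can be labeled so that its edge set is $\{\{1,2\},\dots,\{n-1,n\}\}$. Directed PaWBar algorithm. $G=(V,E)$ is a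 weighted directed graph with weight $a_{ij}\in(0,1)$ for each $(i,j)\in E$. Set $\mu_i(0)=\mu_{i,0}$ for $i\in V$. At each time $t=0,1,2,\dots$: select a random edge $(i,j)\in E$, independently over time, according to a time-invariant probability distribution giving every edge positive probability; then set $\mu_i(t+1)=(\pi_{a_{ij}})_\#\gamma^{\mathrm{opt}}(\mu_i(t),\mu_j(t))$, the measures of all other agents being unchanged. Symmetric PaWBar algorithm. $G=(V,E)$ is an undirected graph. Set $\mu_i(0)=\mu_{i,0}$ for $i\in V$. At each time $t$: select a random edge $\{i,j\}\in E$, independently over time, according to a time-invariant probability distribution giving every edge positive probability; then set $\mu_i(t+1)=\mu_j(t+1)=(\pi_{1/2})_\#\gamma^{\mathrm{opt}}(\mu_i(t),\mu_j(t))$, the measures of all other agents being unchanged. The edge selection process is the random sequence of selected edges; "with probability one" is with respect to its law. *)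

theory Defs
  imports "HOL-Probability.Probability"
begin

section \<open>The Wasserstein space\<close>

definition P2 :: "'a::euclidean_space measure set" where
  "P2 = {\<mu> \<in> space (prob_algebra borel). (\<integral>\<^sup>+ x. ennreal ((norm x)\<^sup>2) \<partial>\<mu>) < \<infinity>}"

definition couplings ::
  "'a::euclidean_space measure \<Rightarrow> 'a measure \<Rightarrow> ('a \<times> 'a) measure set" where
  "couplings \<mu> \<nu> = {\<gamma> \<in> space (prob_algebra (borel \<Otimes>\<^sub>M borel)).
     distr \<gamma> borel fst = \<mu> \<and> distr \<gamma> borel snd = \<nu>}"

definition transport_cost :: "('a::euclidean_space \<times> 'a) measure \<Rightarrow> ennreal" where
  "transport_cost \<gamma> = (\<integral>\<^sup>+ z. ennreal ((norm (fst z - snd z))\<^sup>2) \<partial>\<gamma>)"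

text \<open>Real-valued; the infimum is finite when both arguments are in \<^const>\<open>P2\<close>, the only case used.\<close>

definition W2 :: "'a::euclidean_space measure \<Rightarrow> 'a measure \<Rightarrow> real" where
  "W2 \<mu> \<nu> = sqrt (enn2real (INF \<gamma>\<in>couplings \<mu> \<nu>. transport_cost \<gamma>))"

definition optimal_plan ::
  "'a::euclidean_space measure \<Rightarrow> 'a measure \<Rightarrow> ('a \<times> 'a) measure \<Rightarrow> bool" where
  "optimal_plan \<mu> \<nu> \<gamma> \<longleftrightarrow>
     \<gamma> \<in> couplings \<mu> \<nu> \<and> (\<forall>\<gamma>'\<in>couplings \<mu> \<nu>. transport_cost \<gamma> \<le> transport_cost \<gamma>')"

text \<open>
  Optimal plans need not be unique. A selection fixes one for each pair of measures; it may
  depend on the list \<open>h\<close> of the edges selected so far, so that different optimal plans for the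
  same pair may be used at different times.
\<close>

definition optimal_plan_selection ::
  "('e list \<Rightarrow> 'a::euclidean_space measure \<Rightarrow> 'a measure \<Rightarrow> ('a \<times> 'a) measure) \<Rightarrow> bool" where
  "optimal_plan_selection \<gamma>opt \<longleftrightarrow>
     (\<forall>h. \<forall>\<mu>\<in>P2. \<forall>\<nu>\<in>P2. optimal_plan \<mu> \<nu> (\<gamma>opt h \<mu> \<nu>))"

definition interpolate :: "real \<Rightarrow> 'a::euclidean_space \<times> 'a \<Rightarrow> 'a" where
  "interpolate a z = (1 - a) *\<^sub>R fst z + a *\<^sub>R snd z"


section \<open>Graphs\<close>

definition cycle_graph :: "'v set \<Rightarrow> ('v \<times> 'v) set \<Rightarrow> bool" where
  "cycle_graph V E \<longleftrightarrow> (\<exists>v. bij_betw v {1..card V} V \<and>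
     E = {(v k, v (k + 1)) | k. 1 \<le> k \<and> k < card V} \<union> {(v (card V), v 1)})"

definition line_graph :: "'v set \<Rightarrow> 'v set set \<Rightarrow> bool" where
  "line_graph V E \<longleftrightarrow> (\<exists>v. bij_betw v {1..card V} V \<and>
     E = {{v k, v (k + 1)} | k. 1 \<le> k \<and> k < card V})"


section \<open>The algorithms\<close>

text \<open>The law of a sequence of independent edges, each with distribution \<open>p\<close>.\<close>

definition edge_selection_law :: "'e pmf \<Rightarrow> (nat \<Rightarrow> 'e) measure" where
  "edge_selection_law p = (\<Pi>\<^sub>M t\<in>UNIV. measure_pmf p)"

text \<open>The measure of every agent at every time, as a function of the selected edges \<open>e\<close>.\<close>

primrec directed_pawbar ::
  "(('v \<times> 'v) list \<Rightarrow> 'a::euclidean_space measure \<Rightarrow> 'a measure \<Rightarrow> ('a \<times> 'a) measure) \<Rightarrow>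
   ('v \<times> 'v \<Rightarrow> real) \<Rightarrow> ('v \<Rightarrow> 'a measure) \<Rightarrow> (nat \<Rightarrow> 'v \<times> 'v) \<Rightarrow> nat \<Rightarrow> 'v \<Rightarrow> 'a measure" where
  "directed_pawbar \<gamma>opt a \<mu>0 e 0 = \<mu>0"
| "directed_pawbar \<gamma>opt a \<mu>0 e (Suc t) =
     (let \<mu> = directed_pawbar \<gamma>opt a \<mu>0 e t; i = fst (e t); j = snd (e t);
          \<gamma> = \<gamma>opt (map e [0..<Suc t]) (\<mu> i) (\<mu> j)
      in \<mu>(i := distr \<gamma> borel (interpolate (a (i, j)))))"

text \<open>
  An undirected edge is oriented from its smaller to its larger endpoint. The orientation is
  immaterial: swapping coordinates turns optimal plans into optimal plans and does not affect
  \<open>interpolate (1/2)\<close>, and the selection is arbitrary.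
\<close>

primrec symmetric_pawbar ::
  "('v::linorder set list \<Rightarrow> 'a::euclidean_space measure \<Rightarrow> 'a measure \<Rightarrow> ('a \<times> 'a) measure) \<Rightarrow>
   ('v \<Rightarrow> 'a measure) \<Rightarrow> (nat \<Rightarrow> 'v set) \<Rightarrow> nat \<Rightarrow> 'v \<Rightarrow> 'a measure" where
  "symmetric_pawbar \<gamma>opt \<mu>0 e 0 = \<mu>0"
| "symmetric_pawbar \<gamma>opt \<mu>0 e (Suc t) =
     (let \<mu> = symmetric_pawbar \<gamma>opt \<mu>0 e t; i = Min (e t); j = Max (e t);
          \<gamma> = \<gamma>opt (map e [0..<Suc t]) (\<mu> i) (\<mu> j);
          \<nu> = distr \<gamma> borel (interpolate (1/2))
      in \<mu>(i := \<nu>, j := \<nu>))"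

text \<open>
  \<open>X e t i\<close> is the measure of agent \<open>i\<close> at time \<open>t\<close> when the selected edges are \<open>e\<close>, a random
  sequence with law \<open>L\<close>. A random measure is a measurable map into the space of
  probability measures with the \<open>\<sigma>\<close>-algebra generated by the evaluations on Borel sets.
\<close>

definition reaches_random_consensus ::
  "'v set \<Rightarrow> (nat \<Rightarrow> 'e) measure \<Rightarrow> ('v \<Rightarrow> 'a::euclidean_space measure) \<Rightarrow>
   ((nat \<Rightarrow> 'e) \<Rightarrow> nat \<Rightarrow> 'v \<Rightarrow> 'a measure) \<Rightarrow> bool" where
  "reaches_random_consensus V L \<mu>0 X \<longleftrightarrow>
     (\<exists>\<mu>inf. \<mu>inf \<in> L \<rightarrow>\<^sub>M prob_algebra borel \<and> (\<forall>e\<in>space L. \<mu>inf e \<in> P2) \<and>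
        (AE e in L. \<forall>i\<in>V. (\<lambda>t. W2 (X e t i) (\<mu>inf e)) \<longlonglongrightarrow> 0) \<and>
        ((\<forall>i\<in>V. \<forall>j\<in>V. \<mu>0 i = \<mu>0 j) \<longrightarrow> (AE e in L. \<forall>i\<in>V. \<mu>inf e = \<mu>0 i)))"

end

theory Submission
  imports Defs
begin

text \<open>
  Only consecutive gaps \<open>W2 (X t i) (X t (i + 1))\<close> matter. Moving an agent along a geodesic towards
  its successor shortens its own gap by the amount that the triangle inequality allows the
  preceding gap to grow, so the sum of the gaps along a cycle never increases (on a line, a
  suitably weighted sum). A fixed finite word of edges strictly contracts this sum: on a cycle one
  makes all gaps but one tiny, and the last one is bounded by the others because the cycle closes
  up. The word occurs in disjoint blocks of the selection independently with positive probability,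
  so the expected gaps decay geometrically and are almost surely summable in \<open>t\<close>; since each move
  is bounded by a gap, every agent follows a Cauchy sequence, and all share its limit.

  The metric properties of \<open>W2\<close> rest on gluing a sequence of couplings. Instead of disintegrating,
  the next pair is drawn conditionally on the countable cell of mesh \<open>\<epsilon> t\<close> that contains the current
  endpoint, at the price of an error \<open>\<epsilon> t\<close> in matching the intermediate points.
\<close>

section \<open>Gluing couplings\<close>

text \<open>For d \<ge> 2 the Wasserstein space is not flat: the distance to a fixed measure is in
  general not convex along geodesics. The averaging therefore cannot be reduced to products of
  stochastic matrices as in Euclidean consensus; an update enters only through its distances to the
  two measures it was formed from. With so little information no single step need reduce the gaps:
  on a cycle a gap may merely be handed on to the preceding edge, and on a line the selected gap may
  be zero. This forces contraction along whole words. The choice of optimal plans is arbitrary and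
  may depend on the history, so the gaps carry no regularity as functions of the edge sequence. The
  probabilistic estimates are made for an explicit majorant that sees only where the word occurs,
  and the measurability of the limit comes from finiteness: there are only finitely many possible
  edge prefixes of each length.\<close>

lemma ex_countable_cells:
  fixes \<epsilon> :: real
  assumes "0 < \<epsilon>"
  obtains q :: "'a::euclidean_space \<Rightarrow> nat"
  where "q \<in> borel \<rightarrow>\<^sub>M count_space UNIV" "\<And>x y. q x = q y \<Longrightarrow> dist x y < \<epsilon>"
proof -
  obtain D :: "'a set" where D: "countable D" "\<And>X. open X \<Longrightarrow> X \<noteq> {} \<Longrightarrow> \<exists>d\<in>D. d \<in> X"
    using countable_dense_setE by blast
  have near: "\<exists>k. dist (from_nat_into D k) x < \<epsilon>/2" for x
  proof -
    obtain d where "d \<in> D" "d \<in> ball x (\<epsilon>/2)"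
      using D(2)[of "ball x (\<epsilon>/2)"] assms by auto
    then show ?thesis
      using D(1) by (metis dist_commute from_nat_into_to_nat_on mem_ball)
  qed
  \<comment> \<open>The cell of a point is the first dense point within half the mesh; taking the
    least index makes the choice measurable and the cells disjoint.\<close>
  define q where "q = (\<lambda>x. LEAST k. dist (from_nat_into D k) x < \<epsilon>/2)"
  have q: "dist (from_nat_into D (q x)) x < \<epsilon>/2" for x
    unfolding q_def using near by (rule LeastI_ex)
  show ?thesis
  proof
    show "q \<in> borel \<rightarrow>\<^sub>M count_space UNIV"
      unfolding q_def by measurable
    show "dist x y < \<epsilon>" if "q x = q y" for x y
      using q[of x] q[of y] dist_triangle_half_r[of "from_nat_into D (q x)" x \<epsilon> y] that by simp
  qed
qed

text \<open>The total mass of the projective limit can be read off from its marginal on the empty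
  index set.\<close>

lemma (in Ionescu_Tulcea) prob_space_lim: "prob_space PF.lim"
proof (rule prob_space_distrD)
  show "(\<lambda>x. restrict x {}) \<in> PF.lim \<rightarrow>\<^sub>M PiM {} M"
    by (auto simp: measurable_cong_sets[OF PF.sets_lim refl] intro!: measurable_restrict_subset)
  show "prob_space (distr PF.lim (PiM {} M) (\<lambda>x. restrict x {}))"
    unfolding distr_lim[OF finite.emptyI] by (rule PF.prob_space_P) auto
qed

text \<open>The tower property of the limit law: given the coordinates before \<open>n\<close>,
  coordinate \<open>n\<close> is distributed according to \<open>P n\<close>. This is the only way
  in which the law of the constructed sequence is accessed later.\<close>

lemma (in Ionescu_Tulcea) nn_integral_lim_Suc:
  assumes f[measurable]: "f \<in> borel_measurable (PiM {0..<Suc n} M)"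
  shows "(\<integral>\<^sup>+\<omega>. f (restrict \<omega> {0..<Suc n}) \<partial>PF.lim) =
    (\<integral>\<^sup>+\<omega>. (\<integral>\<^sup>+x. f ((restrict \<omega> {0..<n})(n := x)) \<partial>P n (restrict \<omega> {0..<n})) \<partial>PF.lim)"
proof -
  have r[measurable]: "(\<lambda>\<omega>. restrict \<omega> {0..<m}) \<in> PF.lim \<rightarrow>\<^sub>M PiM {0..<m} M" for m
    by (auto simp: measurable_cong_sets[OF PF.sets_lim refl] intro!: measurable_restrict_subset)
  have up: "up_to {0..<m} = m" for m
    by (intro antisym) (auto simp: up_to_iff, metis (no_types) atLeastLessThan_iff finite_atLeastLessThan le_eq_less_or_eq less_irrefl linorder_not_less up_to_less zero_le)
  \<comment> \<open>\<open>CI\<close> composes kernels up to a bound of the index set and then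
    restricts; on an initial segment the restriction changes nothing.\<close>
  have CI_C: "CI {0..<m} = C 0 m (\<lambda>_. undefined)" for m
  proof -
    have "C 0 m (\<lambda>_. undefined) = distr (C 0 m (\<lambda>_. undefined)) (PiM {0..<0+m} M) (\<lambda>x. restrict x {0..<0+m})"
      by (rule distr_C) (auto simp: space_PiM)
    then show ?thesis unfolding CI_def up by simp
  qed
  have eP[measurable]: "(\<lambda>\<omega>. \<integral>\<^sup>+x. f x \<partial>eP n \<omega>) \<in> borel_measurable (PiM {0..<n} M)"
    by (rule measurable_compose[OF measurable_eP nn_integral_measurable_subprob_algebra[OF f]])
  have "(\<integral>\<^sup>+\<omega>. f (restrict \<omega> {0..<Suc n}) \<partial>PF.lim) = (\<integral>\<^sup>+x. f x \<partial>C 0 (Suc n) (\<lambda>_. undefined))"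
    unfolding CI_C[symmetric] distr_lim[OF finite_atLeastLessThan, symmetric]
    by (subst nn_integral_distr) auto
  also have "\<dots> = (\<integral>\<^sup>+\<omega>. (\<integral>\<^sup>+x. f x \<partial>eP n \<omega>) \<partial>C 0 n (\<lambda>_. undefined))"
    by simp (subst nn_integral_bind[where B="PiM {0..<Suc n} M"],
      auto simp: measurable_cong_sets[OF sets_C refl] space_PiM)
  also have "\<dots> = (\<integral>\<^sup>+\<omega>. (\<integral>\<^sup>+x. f x \<partial>eP n (restrict \<omega> {0..<n})) \<partial>PF.lim)"
    unfolding CI_C[symmetric] distr_lim[OF finite_atLeastLessThan, symmetric]
    by (subst nn_integral_distr) auto
  also have "\<dots> = (\<integral>\<^sup>+\<omega>. (\<integral>\<^sup>+x. f ((restrict \<omega> {0..<n})(n := x)) \<partial>P n (restrict \<omega> {0..<n})) \<partial>PF.lim)"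
    by (intro nn_integral_cong nn_integral_eP f) (simp add: space_PiM PiE_iff)
  finally show ?thesis .
qed

text \<open>Every coupling keeps its exact law because the two marginals at a junction give each
  cell the same mass, so conditioning on cells and averaging again loses nothing. The errors are
  left to the caller: a constant serves the triangle inequality, a summable sequence serves
  completeness.\<close>

lemma ex_glued_sequence:
  fixes \<gamma> :: "nat \<Rightarrow> ('a::euclidean_space \<times> 'a) measure" and \<epsilon> :: "nat \<Rightarrow> real"
  assumes \<gamma>: "\<And>t. \<gamma> t \<in> space (prob_algebra (borel \<Otimes>\<^sub>M borel))"
    and match: "\<And>t. distr (\<gamma> t) borel snd = distr (\<gamma> (Suc t)) borel fst"
    and \<epsilon>: "\<And>t. 0 < \<epsilon> t"
  obtains N :: "(nat \<Rightarrow> 'a \<times> 'a) measure"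
  where "prob_space N" "\<And>t. (\<lambda>\<omega>. \<omega> t) \<in> N \<rightarrow>\<^sub>M borel \<Otimes>\<^sub>M borel"
    "\<And>t. distr N (borel \<Otimes>\<^sub>M borel) (\<lambda>\<omega>. \<omega> t) = \<gamma> t"
    "\<And>t. AE \<omega> in N. dist (snd (\<omega> t)) (fst (\<omega> (Suc t))) < \<epsilon> t"
proof -
  have "\<exists>q::'a \<Rightarrow> nat. q \<in> borel \<rightarrow>\<^sub>M count_space UNIV \<and> (\<forall>x y. q x = q y \<longrightarrow> dist x y < \<epsilon> t)" for t
    using ex_countable_cells[OF \<epsilon>[of t]] by metis
  then obtain q :: "nat \<Rightarrow> 'a \<Rightarrow> nat" where
    q[measurable]: "\<And>t. q t \<in> borel \<rightarrow>\<^sub>M count_space UNIV" and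
    q_dist: "\<And>t x y. q t x = q t y \<Longrightarrow> dist x y < \<epsilon> t"
    by metis
  let ?B = "borel \<Otimes>\<^sub>M borel :: ('a \<times> 'a) measure"
  have sets_\<gamma>[measurable_cong, simp]: "sets (\<gamma> t) = sets ?B" and prob_\<gamma>: "prob_space (\<gamma> t)" for t
    using \<gamma>[of t] by (auto simp: space_prob_algebra)
  have space_\<gamma>[simp]: "space (\<gamma> t) = UNIV" for t
    using sets_eq_imp_space_eq[OF sets_\<gamma>] by (simp add: space_pair_measure)
  define cell where "cell t j = {p::'a\<times>'a. q t (fst p) = j}" for t j
  have cell[measurable]: "cell t j \<in> sets ?B" for t j
  proof -
    have "cell t j = {p \<in> space ?B. q t (fst p) = j}" by (auto simp: cell_def space_pair_measure)
    also have "\<dots> \<in> sets ?B" by measurable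
    finally show ?thesis .
  qed
  have cell': "{p::'a\<times>'a. q t (snd p) = j} \<in> sets ?B" for t j
  proof -
    have "{p::'a\<times>'a. q t (snd p) = j} = {p \<in> space ?B. q t (snd p) = j}" by (auto simp: space_pair_measure)
    also have "\<dots> \<in> sets ?B" by measurable
    finally show ?thesis .
  qed
  \<comment> \<open>The default on null cells only keeps \<open>K t j\<close> a probability measure;
    such cells are entered with probability zero.\<close>
  define K where "K t j = (if emeasure (\<gamma> (Suc t)) (cell t j) = 0 then \<gamma> (Suc t)
      else uniform_measure (\<gamma> (Suc t)) (cell t j))" for t j
  have K: "K t j \<in> space (prob_algebra ?B)" for t j
  proof -
    interpret prob_space "\<gamma> (Suc t)" by (rule prob_\<gamma>)
    show ?thesis
      by (auto simp: K_def space_prob_algebra prob_\<gamma> intro!: prob_space_uniform_measure)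
  qed
  have K_sets[simp, measurable_cong]: "sets (K t j) = sets ?B" for t j
    using K by (auto simp: space_prob_algebra)
  \<comment> \<open>The kernel reads the past only through the countable index of the last endpoint,
    and every function of such an index is measurable.\<close>
  define P where "P n \<omega> = (case n of 0 \<Rightarrow> \<gamma> 0 | Suc t \<Rightarrow> K t (q t (snd (\<omega> t))))"
    for n and \<omega> :: "nat \<Rightarrow> 'a \<times> 'a"
  have P: "P n \<in> PiM {0..<n} (\<lambda>_. ?B) \<rightarrow>\<^sub>M prob_algebra ?B" for n
  proof (cases n)
    case 0
    have "P 0 = (\<lambda>_. \<gamma> 0)" by (simp add: P_def fun_eq_iff)
    then show ?thesis using \<gamma>[of 0] 0 by simp
  next
    case (Suc t)
    have 1: "(\<lambda>\<omega>. q t (snd (\<omega> t))) \<in> PiM {0..<n} (\<lambda>_. ?B) \<rightarrow>\<^sub>M count_space UNIV"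
    proof -
      have [measurable]: "(\<lambda>\<omega>. \<omega> t) \<in> PiM {0..<n} (\<lambda>_. ?B) \<rightarrow>\<^sub>M ?B"
        by (rule measurable_component_singleton) (simp add: Suc)
      show ?thesis by measurable
    qed
    have "(\<lambda>\<omega>. K t (q t (snd (\<omega> t)))) \<in> PiM {0..<n} (\<lambda>_. ?B) \<rightarrow>\<^sub>M prob_algebra ?B"
      by (rule measurable_compose[OF 1]) (use K in auto)
    moreover have "P n = (\<lambda>\<omega>. K t (q t (snd (\<omega> t))))" by (simp add: P_def Suc fun_eq_iff)
    ultimately show ?thesis by simp
  qed
  interpret IT: Ionescu_Tulcea P "\<lambda>_. ?B"
  proof (rule Ionescu_Tulcea.intro)
    show "P i \<in> PiM {0..<i} (\<lambda>_. ?B) \<rightarrow>\<^sub>M subprob_algebra ?B" for i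
      using P by (rule measurable_prob_algebraD)
    show "prob_space (P i x)" if "x \<in> space (PiM {0..<i} (\<lambda>_. ?B))" for i x
      using measurable_space[OF P that] by (auto simp: space_prob_algebra)
  qed
  define N where "N = IT.PF.lim"
  have sets_N[measurable_cong]: "sets N = sets (PiM UNIV (\<lambda>_. ?B))" by (simp add: N_def)
  have coord[measurable]: "(\<lambda>\<omega>. \<omega> t) \<in> N \<rightarrow>\<^sub>M ?B" for t by measurable
  have prob_N: "prob_space N" unfolding N_def by (rule IT.prob_space_lim)
  interpret N: prob_space N by (rule prob_N)
  have step: "(\<integral>\<^sup>+\<omega>. g (\<omega> t) (\<omega> (Suc t)) \<partial>N) = (\<integral>\<^sup>+\<omega>. (\<integral>\<^sup>+x. g (\<omega> t) x \<partial>K t (q t (snd (\<omega> t)))) \<partial>N)"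
    if g[measurable]: "case_prod g \<in> borel_measurable (?B \<Otimes>\<^sub>M ?B)" for g :: "'a\<times>'a \<Rightarrow> 'a\<times>'a \<Rightarrow> ennreal" and t
  proof -
    have "(\<lambda>\<omega>. case_prod g (\<omega> t, \<omega> (Suc t))) \<in> borel_measurable (PiM {0..<Suc (Suc t)} (\<lambda>_. ?B))"
      by (rule measurable_compose[OF _ g]) measurable
    from IT.nn_integral_lim_Suc[OF this] show ?thesis by (simp add: N_def P_def)
  qed
  have zero: "distr N ?B (\<lambda>\<omega>. \<omega> 0) = \<gamma> 0"
  proof (rule measure_eqI)
    fix A assume "A \<in> sets (distr N ?B (\<lambda>\<omega>. \<omega> 0))"
    then have A[measurable]: "A \<in> sets ?B" by simp
    have "(\<lambda>\<omega>. indicator A (\<omega> 0) :: ennreal) \<in> borel_measurable (PiM {0..<Suc 0} (\<lambda>_. ?B))"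
      by measurable
    from IT.nn_integral_lim_Suc[OF this] 
    have "(\<integral>\<^sup>+\<omega>. indicator A (\<omega> 0) \<partial>N) = emeasure (\<gamma> 0) A"
      by (simp add: N_def[symmetric] P_def N.emeasure_space_1)
    moreover have "emeasure (distr N ?B (\<lambda>\<omega>. \<omega> 0)) A = (\<integral>\<^sup>+z. indicator A z \<partial>distr N ?B (\<lambda>\<omega>. \<omega> 0))"
      by simp
    moreover have "\<dots> = (\<integral>\<^sup>+\<omega>. indicator A (\<omega> 0) \<partial>N)"
      by (rule nn_integral_distr) auto
    ultimately show "emeasure (distr N ?B (\<lambda>\<omega>. \<omega> 0)) A = emeasure (\<gamma> 0) A" by simp
  qed simp
  \<comment> \<open>The kernels average to \<open>\<gamma> (Suc t)\<close> when their cell index is drawn from the common marginal.\<close>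
  have marg: "emeasure (\<gamma> t) {p. q t (snd p) = j} = emeasure (\<gamma> (Suc t)) (cell t j)" for t j
  proof -
    have proj: "fst \<in> \<gamma> (Suc t) \<rightarrow>\<^sub>M borel" "snd \<in> \<gamma> t \<rightarrow>\<^sub>M borel"
      by (simp_all add: measurable_cong_sets[OF sets_\<gamma> refl])
    have m: "{x. q t x = j} \<in> sets borel"
      using measurable_sets[OF q, of "{j}" t] by (simp add: vimage_def)
    have "emeasure (distr (\<gamma> t) borel snd) {x. q t x = j} = emeasure (distr (\<gamma> (Suc t)) borel fst) {x. q t x = j}"
      by (simp add: match)
    then show ?thesis
      using m proj by (simp add: emeasure_distr vimage_def cell_def)
  qed
  have idx: "(\<lambda>p. f (q t (snd p))) \<in> borel_measurable ?B" for f :: "nat \<Rightarrow> ennreal" and t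
    by (rule measurable_compose[of "\<lambda>p. q t (snd p)" _ "count_space UNIV"]) auto
  have law: "distr N ?B (\<lambda>\<omega>. \<omega> t) = \<gamma> t" for t
  proof (induction t)
    case (Suc t)
    show ?case
    proof (rule measure_eqI)
      fix A assume "A \<in> sets (distr N ?B (\<lambda>\<omega>. \<omega> (Suc t)))"
      then have A[measurable]: "A \<in> sets ?B" by simp
      have "emeasure (distr N ?B (\<lambda>\<omega>. \<omega> (Suc t))) A = (\<integral>\<^sup>+z. indicator A z \<partial>distr N ?B (\<lambda>\<omega>. \<omega> (Suc t)))"
        by simp
      also have "\<dots> = (\<integral>\<^sup>+\<omega>. indicator A (\<omega> (Suc t)) \<partial>N)"
        by (rule nn_integral_distr) auto
      also have "\<dots> = (\<integral>\<^sup>+\<omega>. emeasure (K t (q t (snd (\<omega> t)))) A \<partial>N)"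
        by (subst step) auto
      also have "\<dots> = (\<integral>\<^sup>+p. emeasure (K t (q t (snd p))) A \<partial>distr N ?B (\<lambda>\<omega>. \<omega> t))"
        by (rule nn_integral_distr[symmetric]) (use idx[of "\<lambda>j. emeasure (K t j) A"] in auto)
      also have "\<dots> = (\<integral>\<^sup>+p. emeasure (K t (q t (snd p))) A \<partial>\<gamma> t)"
        unfolding Suc ..
      \<comment> \<open>Law of total probability: the kernel is constant on each cell, and below the
        mass of the cell cancels against the normalisation of the conditional measure.\<close>
      also have "\<dots> = (\<integral>\<^sup>+p. (\<Sum>j. emeasure (K t j) A * indicator {p. q t (snd p) = j} p) \<partial>\<gamma> t)"
      proof (rule nn_integral_cong)
        fix p :: "'a \<times> 'a"
        have "(\<lambda>j. emeasure (K t j) A * indicator {p. q t (snd p) = j} p) sums 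
           (\<Sum>j\<in>{q t (snd p)}. emeasure (K t j) A * indicator {p. q t (snd p) = j} p)"
          by (rule sums_finite) auto
        then show "emeasure (K t (q t (snd p))) A = (\<Sum>j. emeasure (K t j) A * indicator {p. q t (snd p) = j} p)"
          by (simp add: sums_iff)
      qed
      also have "\<dots> = (\<Sum>j. \<integral>\<^sup>+p. emeasure (K t j) A * indicator {p. q t (snd p) = j} p \<partial>\<gamma> t)"
        by (rule nn_integral_suminf)
          (auto intro!: borel_measurable_times_ennreal borel_measurable_indicator simp: cell')
      also have "\<dots> = (\<Sum>j. emeasure (K t j) A * emeasure (\<gamma> t) {p. q t (snd p) = j})"
        by (intro suminf_cong nn_integral_cmult_indicator) (use cell' in auto)
      also have "\<dots> = (\<Sum>j. emeasure (\<gamma> (Suc t)) (cell t j \<inter> A))"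
      proof (rule suminf_cong)
        fix j
        interpret G: prob_space "\<gamma> (Suc t)" by (rule prob_\<gamma>)
        show "emeasure (K t j) A * emeasure (\<gamma> t) {p. q t (snd p) = j} = emeasure (\<gamma> (Suc t)) (cell t j \<inter> A)"
        proof (cases "emeasure (\<gamma> (Suc t)) (cell t j) = 0")
          case True
          then have "emeasure (\<gamma> (Suc t)) (cell t j \<inter> A) = 0"
            by (intro emeasure_eq_0[OF _ True]) auto
          then show ?thesis using True by (simp add: marg)
        next
          case False
          have "emeasure (K t j) A = emeasure (\<gamma> (Suc t)) (cell t j \<inter> A) / emeasure (\<gamma> (Suc t)) (cell t j)"
            using False by (simp add: K_def)
          then show ?thesis
            using False by (simp add: marg ennreal_divide_times ennreal_divide_self less_top[symmetric])
        qed
      qed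
      also have "\<dots> = emeasure (\<gamma> (Suc t)) (\<Union>j. cell t j \<inter> A)"
      proof (rule suminf_emeasure)
        show "disjoint_family (\<lambda>j. cell t j \<inter> A)" by (auto simp: disjoint_family_on_def cell_def)
      qed auto
      also have "(\<Union>j. cell t j \<inter> A) = A" by (auto simp: cell_def)
      finally show "emeasure (distr N ?B (\<lambda>\<omega>. \<omega> (Suc t))) A = emeasure (\<gamma> (Suc t)) A" .
    qed simp
  qed (rule zero)
  have "AE \<omega> in N. dist (snd (\<omega> t)) (fst (\<omega> (Suc t))) < \<epsilon> t" for t
  proof -
    \<comment> \<open>Indicator of a mismatch of at least the mesh. From a point whose cell has
      positive mass the kernel charges only that cell, so the conditional mean of \<open>bad\<close>
      vanishes.\<close>
    define bad where "bad = (\<lambda>(p::'a\<times>'a) (p'::'a\<times>'a).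
      if \<epsilon> t \<le> dist (snd p) (fst p') then 1 else 0 :: ennreal)"
    have bad: "case_prod bad \<in> borel_measurable (?B \<Otimes>\<^sub>M ?B)"
      unfolding bad_def by measurable
    \<comment> \<open>The set of points in null cells is a countable union of null sets.\<close>
    have "emeasure (\<gamma> t) {p. emeasure (\<gamma> (Suc t)) (cell t (q t (snd p))) = 0} = 0"
    proof -
      have eq: "{p. emeasure (\<gamma> (Suc t)) (cell t (q t (snd p))) = 0} =
          (\<Union>j\<in>{j. emeasure (\<gamma> (Suc t)) (cell t j) = 0}. {p. q t (snd p) = j})" by auto
      show ?thesis unfolding eq
        by (intro null_setsD1 null_sets_UN') (auto simp: marg null_sets_def cell')
    qed
    then have "AE p in \<gamma> t. emeasure (\<gamma> (Suc t)) (cell t (q t (snd p))) \<noteq> 0"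
      by (intro AE_I[where N="{p. emeasure (\<gamma> (Suc t)) (cell t (q t (snd p))) = 0}"])
        (use pred_sets2[OF _ idx, of "{0}" "\<lambda>j. emeasure (\<gamma> (Suc t)) (cell t j)"] in
          \<open>auto simp: pred_def space_pair_measure\<close>)
    then have "AE p in \<gamma> t. (\<integral>\<^sup>+x. bad p x \<partial>K t (q t (snd p))) = 0"
    proof (rule AE_mp, intro AE_I2 impI)
      fix p :: "'a \<times> 'a" assume pos: "emeasure (\<gamma> (Suc t)) (cell t (q t (snd p))) \<noteq> 0"
      interpret G: prob_space "\<gamma> (Suc t)" by (rule prob_\<gamma>)
      have "AE x in K t (q t (snd p)). bad p x = 0"
      proof -
        have "AE x in uniform_measure (\<gamma> (Suc t)) (cell t (q t (snd p))). bad p x = 0"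
        proof (rule AE_uniform_measureI, simp, rule AE_I2, rule impI)
          fix x assume "x \<in> cell t (q t (snd p))"
          then have "dist (snd p) (fst x) < \<epsilon> t" by (intro q_dist) (simp add: cell_def)
          then show "bad p x = 0" by (simp add: bad_def)
        qed
        moreover have "K t (q t (snd p)) = uniform_measure (\<gamma> (Suc t)) (cell t (q t (snd p)))"
          using pos by (simp add: K_def)
        ultimately show ?thesis by metis
      qed
      then show "(\<integral>\<^sup>+x. bad p x \<partial>K t (q t (snd p))) = 0"
        by (subst nn_integral_cong_AE[where v="\<lambda>_. 0"]) auto
    qed
    then have "AE \<omega> in N. (\<integral>\<^sup>+x. bad (\<omega> t) x \<partial>K t (q t (snd (\<omega> t)))) = 0"
      unfolding law[of t, symmetric] by (rule AE_distrD[OF coord])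
    then have "(\<integral>\<^sup>+\<omega>. bad (\<omega> t) (\<omega> (Suc t)) \<partial>N) = 0"
      unfolding step[OF bad] by (subst nn_integral_cong_AE[where v="\<lambda>_. 0"]) auto
    moreover have "(\<lambda>\<omega>. bad (\<omega> t) (\<omega> (Suc t))) \<in> borel_measurable N"
      using measurable_compose[OF _ bad, of "\<lambda>\<omega>. (\<omega> t, \<omega> (Suc t))" N] by simp
    ultimately have "AE \<omega> in N. bad (\<omega> t) (\<omega> (Suc t)) = 0"
      by (simp add: nn_integral_0_iff_AE)
    then show ?thesis
      by eventually_elim (auto simp: bad_def split: if_splits)
  qed
  then show ?thesis
    using that[OF prob_N coord law] by blast
qed

section \<open>The Wasserstein distance\<close>

text \<open>A bound on the L2 norm instead of the norm itself: the real \<open>B\<close> carries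
  finiteness along, so adding, dominating and passing to limits create no integrability
  obligations.\<close>

definition L2_le :: "'a measure \<Rightarrow> ('a \<Rightarrow> real) \<Rightarrow> real \<Rightarrow> bool" where
  "L2_le N f B \<longleftrightarrow> f \<in> borel_measurable N \<and> 0 \<le> B \<and> (\<integral>\<^sup>+x. ennreal ((f x)\<^sup>2) \<partial>N) \<le> ennreal (B\<^sup>2)"

lemma L2_leD:
  assumes "L2_le N f B"
  shows "f \<in> borel_measurable N" "0 \<le> B" "(\<integral>\<^sup>+x. ennreal ((f x)\<^sup>2) \<partial>N) \<le> ennreal (B\<^sup>2)"
  using assms by (auto simp: L2_le_def)

lemma L2_le_product:
  assumes u: "L2_le N u A" and v: "L2_le N v B"
  shows "(\<integral>\<^sup>+x. ennreal \<bar>u x * v x\<bar> \<partial>N) \<le> ennreal (A * B)"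
proof -
  note [measurable] = L2_leD(1)[OF u] L2_leD(1)[OF v]
  let ?I = "\<integral>\<^sup>+x. ennreal \<bar>u x * v x\<bar> \<partial>N"
  have "?I\<^sup>2 = (\<integral>\<^sup>+x. ennreal \<bar>u x\<bar> * ennreal \<bar>v x\<bar> \<partial>N)\<^sup>2"
    by (simp add: abs_mult ennreal_mult)
  also have "\<dots> \<le> (\<integral>\<^sup>+x. (ennreal \<bar>u x\<bar>)\<^sup>2 \<partial>N) * (\<integral>\<^sup>+x. (ennreal \<bar>v x\<bar>)\<^sup>2 \<partial>N)"
    by (rule Cauchy_Schwarz_nn_integral) auto
  also have "\<dots> = (\<integral>\<^sup>+x. ennreal ((u x)\<^sup>2) \<partial>N) * (\<integral>\<^sup>+x. ennreal ((v x)\<^sup>2) \<partial>N)"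
    by (simp add: ennreal_power)
  also have "\<dots> \<le> ennreal (A\<^sup>2) * ennreal (B\<^sup>2)"
    by (intro mult_mono L2_leD(3) u v) auto
  also have "\<dots> = ennreal ((A * B)\<^sup>2)"
    by (simp add: ennreal_mult power_mult_distrib)
  finally have *: "?I\<^sup>2 \<le> ennreal ((A * B)\<^sup>2)" .
  show ?thesis
  proof (cases ?I rule: ennreal_cases)
    case (real r)
    with * have "r\<^sup>2 \<le> (A * B)\<^sup>2" by (simp add: ennreal_power)
    then have "r \<le> A * B"
      by (rule power2_le_imp_le) (use L2_leD(2)[OF u] L2_leD(2)[OF v] in simp)
    then show ?thesis using real by (simp add: ennreal_leI)
  next
    case top
    then show ?thesis using * by (simp add: power2_eq_square ennreal_mult_top top_unique)
  qed
qed

text \<open>Minkowski's inequality: the cross term of the expanded square is controlled by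
  Cauchy-Schwarz.\<close>

lemma L2_le_add:
  assumes u: "L2_le N u A" and v: "L2_le N v B"
  shows "L2_le N (\<lambda>x. u x + v x) (A + B)"
proof -
  note [measurable] = L2_leD(1)[OF u] L2_leD(1)[OF v]
  note nn = L2_leD(2)[OF u] L2_leD(2)[OF v]
  have "(\<integral>\<^sup>+x. ennreal ((u x + v x)\<^sup>2) \<partial>N) \<le>
      (\<integral>\<^sup>+x. ennreal ((u x)\<^sup>2) + 2 * ennreal \<bar>u x * v x\<bar> + ennreal ((v x)\<^sup>2) \<partial>N)"
  proof (rule nn_integral_mono)
    fix x
    have "(u x + v x)\<^sup>2 \<le> (u x)\<^sup>2 + 2 * \<bar>u x * v x\<bar> + (v x)\<^sup>2"
      by (simp add: power2_sum)
    then have "ennreal ((u x + v x)\<^sup>2) \<le> ennreal ((u x)\<^sup>2 + 2 * \<bar>u x * v x\<bar> + (v x)\<^sup>2)"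
      by (rule ennreal_leI)
    also have "\<dots> = ennreal ((u x)\<^sup>2) + 2 * ennreal \<bar>u x * v x\<bar> + ennreal ((v x)\<^sup>2)"
      by (simp add: ennreal_mult')
    finally show "ennreal ((u x + v x)\<^sup>2) \<le> \<dots>" .
  qed
  also have "\<dots> = (\<integral>\<^sup>+x. ennreal ((u x)\<^sup>2) \<partial>N) + 2 * (\<integral>\<^sup>+x. ennreal \<bar>u x * v x\<bar> \<partial>N) + (\<integral>\<^sup>+x. ennreal ((v x)\<^sup>2) \<partial>N)"
    by (simp add: nn_integral_add nn_integral_cmult)
  also have "\<dots> \<le> ennreal (A\<^sup>2) + 2 * ennreal (A * B) + ennreal (B\<^sup>2)"
    by (intro add_mono mult_left_mono L2_leD(3) L2_le_product u v) auto
  also have "\<dots> = ennreal (A\<^sup>2 + 2 * (A * B) + B\<^sup>2)"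
    using nn by (simp add: ennreal_mult')
  also have "A\<^sup>2 + 2 * (A * B) + B\<^sup>2 = (A + B)\<^sup>2"
    by (simp add: power2_sum)
  finally show ?thesis using nn by (simp add: L2_le_def)
qed

lemma (in prob_space) L2_le_const: "0 \<le> c \<Longrightarrow> L2_le M (\<lambda>_. c) c"
  by (simp add: L2_le_def emeasure_space_1)

lemma L2_le_AE_mono:
  assumes "L2_le N u A" "v \<in> borel_measurable N" "AE x in N. \<bar>v x\<bar> \<le> u x"
  shows "L2_le N v A"
proof -
  have "(\<integral>\<^sup>+x. ennreal ((v x)\<^sup>2) \<partial>N) \<le> (\<integral>\<^sup>+x. ennreal ((u x)\<^sup>2) \<partial>N)"
  proof (rule nn_integral_mono_AE)
    show "AE x in N. ennreal ((v x)\<^sup>2) \<le> ennreal ((u x)\<^sup>2)"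
      using assms(3) by eventually_elim (intro ennreal_leI, simp add: abs_le_square_iff[symmetric])
  qed
  with assms(1,2) show ?thesis by (auto simp: L2_le_def)
qed

lemma L2_le_mono: "L2_le N u A \<Longrightarrow> A \<le> B \<Longrightarrow> L2_le N u B"
  unfolding L2_le_def
  by (auto intro!: power_mono elim!: order_trans simp: ennreal_leI)

lemma (in prob_space) L2_le_nn_integral:
  assumes "L2_le M u A"
  shows "(\<integral>\<^sup>+x. ennreal \<bar>u x\<bar> \<partial>M) \<le> ennreal A"
  using L2_le_product[OF assms L2_le_const[of 1]] by simp

text \<open>Fatou's lemma for the squares.\<close>

lemma L2_le_lim:
  assumes f: "\<And>s. L2_le N (f s) B" and g[measurable]: "g \<in> borel_measurable N"
    and lim: "AE x in N. (\<lambda>s. f s x) \<longlonglongrightarrow> g x"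
  shows "L2_le N g B"
proof -
  note [measurable] = L2_leD(1)[OF f]
  have "(\<integral>\<^sup>+x. ennreal ((g x)\<^sup>2) \<partial>N) = (\<integral>\<^sup>+x. liminf (\<lambda>s. ennreal ((f s x)\<^sup>2)) \<partial>N)"
  proof (rule nn_integral_cong_AE)
    show "AE x in N. ennreal ((g x)\<^sup>2) = liminf (\<lambda>s. ennreal ((f s x)\<^sup>2))"
      using lim
    proof eventually_elim
      case (elim x)
      then have "(\<lambda>s. ennreal ((f s x)\<^sup>2)) \<longlonglongrightarrow> ennreal ((g x)\<^sup>2)"
        by (intro tendsto_ennrealI tendsto_power)
      then show ?case by (rule lim_imp_Liminf[OF sequentially_bot, symmetric])
    qed
  qed
  also have "\<dots> \<le> liminf (\<lambda>s. \<integral>\<^sup>+x. ennreal ((f s x)\<^sup>2) \<partial>N)"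
    by (rule nn_integral_liminf) auto
  also have "\<dots> \<le> liminf (\<lambda>s::nat. ennreal (B\<^sup>2))"
    by (intro Liminf_mono always_eventually allI L2_leD(3)[OF f])
  also have "\<dots> = ennreal (B\<^sup>2)" by (simp add: Liminf_const)
  finally show ?thesis using L2_leD(2)[OF f] by (simp add: L2_le_def)
qed

lemma L2_le_distr:
  assumes "g \<in> N \<rightarrow>\<^sub>M M'" "f \<in> borel_measurable M'"
  shows "L2_le (distr N M' g) f B \<longleftrightarrow> L2_le N (\<lambda>x. f (g x)) B"
  using assms by (auto simp: L2_le_def nn_integral_distr)

section \<open>Second moments, couplings and transport cost\<close>

lemma P2D:
  assumes "\<mu> \<in> P2"
  shows "prob_space \<mu>" "sets \<mu> = sets borel" "space \<mu> = UNIV"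
  using assms sets_eq_imp_space_eq[of \<mu> borel] by (auto simp: P2_def space_prob_algebra)

lemma P2_iff_L2_le:
  assumes "\<mu> \<in> space (prob_algebra borel)"
  shows "\<mu> \<in> P2 \<longleftrightarrow> (\<exists>B. L2_le \<mu> norm B)"
proof
  let ?I = "\<integral>\<^sup>+ x. ennreal ((norm x)\<^sup>2) \<partial>\<mu>"
  have meas: "norm \<in> borel_measurable \<mu>"
    using assms by (simp add: space_prob_algebra cong: measurable_cong_sets)
  assume "\<mu> \<in> P2"
  then have fin: "?I < \<infinity>" by (simp add: P2_def)
  then have "?I = ennreal ((sqrt (enn2real ?I))\<^sup>2)" by simp
  then have "L2_le \<mu> norm (sqrt (enn2real ?I))"
    using meas by (simp add: L2_le_def)
  then show "\<exists>B. L2_le \<mu> norm B" ..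
next
  assume "\<exists>B. L2_le \<mu> norm B"
  then show "\<mu> \<in> P2"
    using assms by (auto simp: P2_def L2_le_def elim: le_less_trans)
qed

lemma P2_norm_L2_le: "\<mu> \<in> P2 \<Longrightarrow> \<exists>B. L2_le \<mu> norm B"
  using P2_iff_L2_le[of \<mu>] by (simp add: P2_def)

lemma P2_distr:
  assumes "prob_space N" and X: "X \<in> borel_measurable N" and "L2_le N (\<lambda>\<omega>. norm (X \<omega>)) B"
  shows "distr N borel X \<in> P2"
proof -
  have "distr N borel X \<in> space (prob_algebra borel)"
    using prob_space.prob_space_distr[OF assms(1) X] by (simp add: space_prob_algebra)
  moreover have "L2_le (distr N borel X) norm B"
    using assms by (subst L2_le_distr) auto
  ultimately show ?thesis using P2_iff_L2_le by blast
qed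

lemma couplingsD:
  assumes "\<gamma> \<in> couplings \<mu> \<nu>"
  shows "prob_space \<gamma>" "sets \<gamma> = sets (borel \<Otimes>\<^sub>M borel)"
    "distr \<gamma> borel fst = \<mu>" "distr \<gamma> borel snd = \<nu>" "fst \<in> \<gamma> \<rightarrow>\<^sub>M borel" "snd \<in> \<gamma> \<rightarrow>\<^sub>M borel"
  using assms by (auto simp: couplings_def space_prob_algebra cong: measurable_cong_sets)

lemma W2_nonneg [simp]: "0 \<le> W2 \<mu> \<nu>"
  by (simp add: W2_def)

lemma W2_le_coupling:
  assumes "\<gamma> \<in> couplings \<mu> \<nu>" "L2_le \<gamma> (\<lambda>z. norm (fst z - snd z)) B"
  shows "W2 \<mu> \<nu> \<le> B"
proof -
  have "(INF \<gamma>\<in>couplings \<mu> \<nu>. transport_cost \<gamma>) \<le> ennreal (B\<^sup>2)"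
    using assms by (intro INF_lower2[OF assms(1)]) (simp add: transport_cost_def L2_le_def)
  then have "enn2real (INF \<gamma>\<in>couplings \<mu> \<nu>. transport_cost \<gamma>) \<le> B\<^sup>2"
    by (intro enn2real_leI) auto
  then show ?thesis
    using L2_leD(2)[OF assms(2)] by (auto simp: W2_def intro: real_le_lsqrt)
qed

text \<open>The joint law of two random variables on one probability space is a coupling. Through
  this lemma estimates on a glued sequence become estimates of \<open>W2\<close>.\<close>

lemma W2_distr_le:
  assumes "prob_space N" and X: "X \<in> borel_measurable N" and Y: "Y \<in> borel_measurable N"
    and L: "L2_le N (\<lambda>\<omega>. norm (X \<omega> - Y \<omega>)) B"
  shows "W2 (distr N borel X) (distr N borel Y) \<le> B"
proof (rule W2_le_coupling)
  have XY: "(\<lambda>\<omega>. (X \<omega>, Y \<omega>)) \<in> N \<rightarrow>\<^sub>M borel \<Otimes>\<^sub>M borel" using X Y by simp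
  let ?\<gamma> = "distr N (borel \<Otimes>\<^sub>M borel) (\<lambda>\<omega>. (X \<omega>, Y \<omega>))"
  show "?\<gamma> \<in> couplings (distr N borel X) (distr N borel Y)"
    using prob_space.prob_space_distr[OF assms(1) XY]
    by (simp add: couplings_def space_prob_algebra distr_distr[OF _ XY] comp_def)
  show "L2_le ?\<gamma> (\<lambda>z. norm (fst z - snd z)) B"
    by (subst L2_le_distr[OF XY]) (use L in auto)
qed

lemma coupling_L2_finite:
  assumes "\<mu> \<in> P2" "\<nu> \<in> P2" and \<gamma>: "\<gamma> \<in> couplings \<mu> \<nu>"
  obtains B where "L2_le \<gamma> (\<lambda>z. norm (fst z - snd z)) B"
proof -
  obtain A B where "L2_le \<mu> norm A" "L2_le \<nu> norm B"
    using P2_norm_L2_le[OF assms(1)] P2_norm_L2_le[OF assms(2)] by blast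
  then have "L2_le \<gamma> (\<lambda>z. norm (fst z)) A" "L2_le \<gamma> (\<lambda>z. norm (snd z)) B"
    using L2_le_distr[of fst \<gamma> borel norm A] L2_le_distr[of snd \<gamma> borel norm B] couplingsD[OF \<gamma>] by auto
  then have "L2_le \<gamma> (\<lambda>z. norm (fst z) + norm (snd z)) (A + B)"
    by (rule L2_le_add)
  then have "L2_le \<gamma> (\<lambda>z. norm (fst z - snd z)) (A + B)"
    by (rule L2_le_AE_mono) (use couplingsD(5,6)[OF \<gamma>] in \<open>auto simp: norm_triangle_ineq4\<close>)
  then show ?thesis using that by blast
qed

lemma couplings_nonempty:
  assumes "\<mu> \<in> P2" "\<nu> \<in> P2"
  shows "\<exists>\<gamma>. \<gamma> \<in> couplings \<mu> \<nu>"
proof -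
  note [measurable_cong] = P2D(2)[OF assms(1)] P2D(2)[OF assms(2)]
  interpret M: prob_space \<mu> by (rule P2D[OF assms(1)])
  interpret N: prob_space \<nu> by (rule P2D[OF assms(2)])
  interpret pair_prob_space \<mu> \<nu> ..
  have s: "sets (\<mu> \<Otimes>\<^sub>M \<nu>) = sets (borel \<Otimes>\<^sub>M borel)"
    by (intro sets_pair_measure_cong P2D assms)
  have m: "fst \<in> (\<mu> \<Otimes>\<^sub>M \<nu>) \<rightarrow>\<^sub>M borel" "snd \<in> (\<mu> \<Otimes>\<^sub>M \<nu>) \<rightarrow>\<^sub>M borel"
    using s by (auto cong: measurable_cong_sets)
  have "distr (\<mu> \<Otimes>\<^sub>M \<nu>) borel fst = \<mu>"
  proof (rule measure_eqI)
    fix A assume "A \<in> sets (distr (\<mu> \<Otimes>\<^sub>M \<nu>) borel fst)"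
    then have A: "A \<in> sets \<mu>" by (simp add: P2D[OF assms(1)])
    have "fst -` A \<inter> space (\<mu> \<Otimes>\<^sub>M \<nu>) = A \<times> space \<nu>"
      using P2D(3) assms by (auto simp: space_pair_measure)
    then show "emeasure (distr (\<mu> \<Otimes>\<^sub>M \<nu>) borel fst) A = emeasure \<mu> A"
      using A m by (simp add: emeasure_distr P2D[OF assms(1)] N.emeasure_pair_measure_Times N.emeasure_space_1)
  qed (simp add: P2D[OF assms(1)])
  moreover have "distr (\<mu> \<Otimes>\<^sub>M \<nu>) borel snd = \<nu>"
  proof (rule measure_eqI)
    fix A assume "A \<in> sets (distr (\<mu> \<Otimes>\<^sub>M \<nu>) borel snd)"
    then have A: "A \<in> sets \<nu>" by (simp add: P2D[OF assms(2)])
    have "snd -` A \<inter> space (\<mu> \<Otimes>\<^sub>M \<nu>) = space \<mu> \<times> A"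
      using P2D(3) assms by (auto simp: space_pair_measure)
    then show "emeasure (distr (\<mu> \<Otimes>\<^sub>M \<nu>) borel snd) A = emeasure \<nu> A"
      using A m by (simp add: emeasure_distr P2D[OF assms(2)] N.emeasure_pair_measure_Times M.emeasure_space_1)
  qed (simp add: P2D[OF assms(2)])
  ultimately have "\<mu> \<Otimes>\<^sub>M \<nu> \<in> couplings \<mu> \<nu>"
    using s prob_space_axioms by (simp add: couplings_def space_prob_algebra)
  then show ?thesis ..
qed

text \<open>\<open>W2\<close> passes through \<open>enn2real\<close>, which sends infinity to 0. The
  infimum can be recovered because the product coupling exists and every coupling of measures in
  \<open>P2\<close> has finite cost.\<close>

lemma W2_INF:
  assumes "\<mu> \<in> P2" "\<nu> \<in> P2"
  shows "(INF \<gamma>\<in>couplings \<mu> \<nu>. transport_cost \<gamma>) = ennreal ((W2 \<mu> \<nu>)\<^sup>2)"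
proof -
  obtain \<gamma> where \<gamma>: "\<gamma> \<in> couplings \<mu> \<nu>" using couplings_nonempty[OF assms] by blast
  obtain B where "L2_le \<gamma> (\<lambda>z. norm (fst z - snd z)) B" by (rule coupling_L2_finite[OF assms \<gamma>])
  then have "transport_cost \<gamma> \<le> ennreal (B\<^sup>2)" by (simp add: L2_le_def transport_cost_def)
  then have "(INF \<gamma>\<in>couplings \<mu> \<nu>. transport_cost \<gamma>) < top"
    using INF_lower[OF \<gamma>, of transport_cost] by (meson ennreal_less_top le_less_trans)
  then show ?thesis by (simp add: W2_def)
qed

lemma coupling_W2_less:
  assumes "\<mu> \<in> P2" "\<nu> \<in> P2" "W2 \<mu> \<nu> < B"
  obtains \<gamma> where "\<gamma> \<in> couplings \<mu> \<nu>" "L2_le \<gamma> (\<lambda>z. norm (fst z - snd z)) B"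
proof -
  have B: "0 < B" using assms(3) W2_nonneg[of \<mu> \<nu>] by linarith
  have "(W2 \<mu> \<nu>)\<^sup>2 < B\<^sup>2" using assms(3) by (intro power_strict_mono) auto
  then have "(INF \<gamma>\<in>couplings \<mu> \<nu>. transport_cost \<gamma>) < ennreal (B\<^sup>2)"
    unfolding W2_INF[OF assms(1,2)] using B by (simp add: ennreal_less_iff)
  then obtain \<gamma> where \<gamma>: "\<gamma> \<in> couplings \<mu> \<nu>" and "transport_cost \<gamma> < ennreal (B\<^sup>2)"
    by (auto simp: INF_less_iff)
  then have "L2_le \<gamma> (\<lambda>z. norm (fst z - snd z)) B"
    using B couplingsD(5,6)[OF \<gamma>] by (simp add: L2_le_def transport_cost_def)
  then show ?thesis using that \<gamma> by blast
qed

lemma optimal_plan_L2_le: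
  assumes "\<mu> \<in> P2" "\<nu> \<in> P2" "optimal_plan \<mu> \<nu> \<gamma>"
  shows "\<gamma> \<in> couplings \<mu> \<nu>" "L2_le \<gamma> (\<lambda>z. norm (fst z - snd z)) (W2 \<mu> \<nu>)"
proof -
  show \<gamma>: "\<gamma> \<in> couplings \<mu> \<nu>" using assms(3) by (simp add: optimal_plan_def)
  have "transport_cost \<gamma> \<le> (INF \<gamma>\<in>couplings \<mu> \<nu>. transport_cost \<gamma>)"
    using assms(3) by (intro INF_greatest) (simp add: optimal_plan_def)
  then show "L2_le \<gamma> (\<lambda>z. norm (fst z - snd z)) (W2 \<mu> \<nu>)"
    using couplingsD(5,6)[OF \<gamma>] unfolding W2_INF[OF assms(1,2)] by (simp add: L2_le_def transport_cost_def)
qed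

lemma P2_L2_le:
  assumes "prob_space N" "X \<in> borel_measurable N" "distr N borel X \<in> P2"
  obtains B where "L2_le N (\<lambda>\<omega>. norm (X \<omega>)) B"
proof -
  obtain B where "L2_le (distr N borel X) norm B"
    using P2_norm_L2_le[OF assms(3)] by blast
  then show ?thesis using that L2_le_distr[OF assms(2), of norm B] by simp
qed

section \<open>Metric properties and geodesic interpolation\<close>

lemma W2_refl: "\<mu> \<in> P2 \<Longrightarrow> W2 \<mu> \<mu> = 0"
proof (rule antisym)
  assume \<mu>: "\<mu> \<in> P2"
  have d: "distr \<mu> borel (\<lambda>x. x) = \<mu>" by (rule distr_id2) (simp add: P2D(2)[OF \<mu>])
  have "W2 (distr \<mu> borel (\<lambda>x. x)) (distr \<mu> borel (\<lambda>x. x)) \<le> 0"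
    using P2D[OF \<mu>] by (intro W2_distr_le) (auto simp: L2_le_def cong: measurable_cong_sets)
  then show "W2 \<mu> \<mu> \<le> 0" by (simp add: d)
qed simp

lemma W2_commute_le:
  assumes "\<mu> \<in> P2" "\<nu> \<in> P2"
  shows "W2 \<nu> \<mu> \<le> W2 \<mu> \<nu>"
proof (rule field_le_epsilon)
  fix e :: real assume "0 < e"
  then obtain \<gamma> where \<gamma>: "\<gamma> \<in> couplings \<mu> \<nu>" "L2_le \<gamma> (\<lambda>z. norm (fst z - snd z)) (W2 \<mu> \<nu> + e)"
    using coupling_W2_less[OF assms, of "W2 \<mu> \<nu> + e"] by auto
  have "W2 (distr \<gamma> borel snd) (distr \<gamma> borel fst) \<le> W2 \<mu> \<nu> + e"
    by (intro W2_distr_le couplingsD[OF \<gamma>(1)]) (use \<gamma>(2) in \<open>simp add: norm_minus_commute\<close>)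
  then show "W2 \<nu> \<mu> \<le> W2 \<mu> \<nu> + e" by (simp add: couplingsD[OF \<gamma>(1)])
qed

lemma W2_commute: "\<mu> \<in> P2 \<Longrightarrow> \<nu> \<in> P2 \<Longrightarrow> W2 \<mu> \<nu> = W2 \<nu> \<mu>"
  by (intro antisym W2_commute_le)

text \<open>Pointwise, the interpolated point divides the segment from \<open>fst z\<close> to
  \<open>snd z\<close> in the ratio a : 1 - a, so the optimal cost scales accordingly. These three
  facts are all that the convergence proofs use about an update.\<close>

lemma optimal_plan_interpolate:
  assumes "\<mu> \<in> P2" "\<nu> \<in> P2" "optimal_plan \<mu> \<nu> \<gamma>" "0 \<le> a" "a \<le> 1"
  shows "distr \<gamma> borel (interpolate a) \<in> P2"
    and "W2 \<mu> (distr \<gamma> borel (interpolate a)) \<le> a * W2 \<mu> \<nu>"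
    and "W2 (distr \<gamma> borel (interpolate a)) \<nu> \<le> (1 - a) * W2 \<mu> \<nu>"
proof -
  note \<gamma> = optimal_plan_L2_le[OF assms(1-3)]
  note c = couplingsD[OF \<gamma>(1)]
  have m[measurable]: "interpolate a \<in> \<gamma> \<rightarrow>\<^sub>M borel"
    unfolding interpolate_def[abs_def]
    by (intro borel_measurable_add borel_measurable_scaleR borel_measurable_const c(5,6))
  note d[measurable] = L2_leD(1)[OF \<gamma>(2)]
  have scale: "L2_le \<gamma> (\<lambda>z. b * norm (fst z - snd z)) (b * W2 \<mu> \<nu>)" if "0 \<le> b" for b
  proof -
    have "(\<integral>\<^sup>+z. ennreal ((b * norm (fst z - snd z))\<^sup>2) \<partial>\<gamma>) =
        ennreal (b\<^sup>2) * (\<integral>\<^sup>+z. ennreal ((norm (fst z - snd z))\<^sup>2) \<partial>\<gamma>)"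
      by (subst nn_integral_cmult[symmetric]) (auto simp: power_mult_distrib ennreal_mult)
    also have "\<dots> \<le> ennreal (b\<^sup>2) * ennreal ((W2 \<mu> \<nu>)\<^sup>2)"
      by (intro mult_left_mono L2_leD(3)[OF \<gamma>(2)]) auto
    finally show ?thesis
      using that by (simp add: L2_le_def power_mult_distrib ennreal_mult)
  qed
  have 1: "fst z - interpolate a z = a *\<^sub>R (fst z - snd z)" for z :: "'a \<times> 'a"
    by (simp add: interpolate_def algebra_simps)
  have 2: "interpolate a z - snd z = (1 - a) *\<^sub>R (fst z - snd z)" for z :: "'a \<times> 'a"
    by (simp add: interpolate_def algebra_simps)
  have L: "L2_le \<gamma> (\<lambda>z. norm (fst z - interpolate a z)) (a * W2 \<mu> \<nu>)"
    "L2_le \<gamma> (\<lambda>z. norm (interpolate a z - snd z)) ((1 - a) * W2 \<mu> \<nu>)"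
    using scale[of a] scale[of "1 - a"] assms(4,5) by (simp_all add: 1 2)
  show "W2 \<mu> (distr \<gamma> borel (interpolate a)) \<le> a * W2 \<mu> \<nu>"
    using W2_distr_le[OF c(1) c(5) m L(1)] by (simp add: c)
  show "W2 (distr \<gamma> borel (interpolate a)) \<nu> \<le> (1 - a) * W2 \<mu> \<nu>"
    using W2_distr_le[OF c(1) m c(6) L(2)] by (simp add: c)
  obtain B where "L2_le \<gamma> (\<lambda>z. norm (fst z)) B"
    using P2_L2_le[OF c(1,5)] assms(1) c by auto
  from L2_le_add[OF this L(1)]
  have "L2_le \<gamma> (\<lambda>z. norm (interpolate a z)) (B + a * W2 \<mu> \<nu>)"
  proof (rule L2_le_AE_mono)
    show "AE z in \<gamma>. \<bar>norm (interpolate a z)\<bar> \<le> norm (fst z) + norm (fst z - interpolate a z)"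
      by (intro AE_I2) (metis abs_norm_cancel norm_minus_commute norm_triangle_sub)
  qed auto
  then show "distr \<gamma> borel (interpolate a) \<in> P2"
    by (rule P2_distr[OF c(1) m])
qed

lemma W2_triangle:
  assumes P: "\<mu> \<in> P2" "\<nu> \<in> P2" "\<rho> \<in> P2"
  shows "W2 \<mu> \<rho> \<le> W2 \<mu> \<nu> + W2 \<nu> \<rho>"
proof (rule field_le_epsilon)
  fix e :: real assume "0 < e"
  then have e: "0 < e/3" by simp
  obtain \<gamma>1 where \<gamma>1: "\<gamma>1 \<in> couplings \<mu> \<nu>" "L2_le \<gamma>1 (\<lambda>z. norm (fst z - snd z)) (W2 \<mu> \<nu> + e/3)"
    using coupling_W2_less[OF P(1,2), of "W2 \<mu> \<nu> + e/3"] e by auto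
  obtain \<gamma>2 where \<gamma>2: "\<gamma>2 \<in> couplings \<nu> \<rho>" "L2_le \<gamma>2 (\<lambda>z. norm (fst z - snd z)) (W2 \<nu> \<rho> + e/3)"
    using coupling_W2_less[OF P(2,3), of "W2 \<nu> \<rho> + e/3"] e by auto
  \<comment> \<open>Padding: a coupling of \<open>\<rho>\<close> with itself can be repeated
    forever, which extends the two couplings to an infinite sequence with matching
    marginals.\<close>
  obtain \<gamma>3 where \<gamma>3: "\<gamma>3 \<in> couplings \<rho> \<rho>" using couplings_nonempty P by blast
  define \<gamma> where "\<gamma> t = (if t = 0 then \<gamma>1 else if t = 1 then \<gamma>2 else \<gamma>3)" for t :: nat
  obtain N where N: "prob_space N" "\<And>t. (\<lambda>\<omega>. \<omega> t) \<in> N \<rightarrow>\<^sub>M borel \<Otimes>\<^sub>M borel"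
    "\<And>t. distr N (borel \<Otimes>\<^sub>M borel) (\<lambda>\<omega>. \<omega> t) = \<gamma> t"
    "\<And>t. AE \<omega> in N. dist (snd (\<omega> t)) (fst (\<omega> (Suc t))) < e/3"
  proof (rule ex_glued_sequence[of \<gamma> "\<lambda>_. e/3"])
    show "\<gamma> t \<in> space (prob_algebra (borel \<Otimes>\<^sub>M borel))" for t
      using \<gamma>1(1) \<gamma>2(1) \<gamma>3 by (simp add: \<gamma>_def couplings_def)
    show "distr (\<gamma> t) borel snd = distr (\<gamma> (Suc t)) borel fst" for t
      using couplingsD(3,4)[OF \<gamma>1(1)] couplingsD(3,4)[OF \<gamma>2(1)] couplingsD(3,4)[OF \<gamma>3]
      by (simp add: \<gamma>_def)
  qed (use e in blast)+
  note [measurable] = N(2)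
  interpret N: prob_space N by (rule N(1))
  have \<gamma>01: "\<gamma> 0 = \<gamma>1" "\<gamma> 1 = \<gamma>2" by (auto simp: \<gamma>_def)
  have L: "L2_le N (\<lambda>\<omega>. norm (fst (\<omega> 0) - snd (\<omega> 0))) (W2 \<mu> \<nu> + e/3)"
    "L2_le N (\<lambda>\<omega>. norm (fst (\<omega> 1) - snd (\<omega> 1))) (W2 \<nu> \<rho> + e/3)"
    using \<gamma>1(2) \<gamma>2(2) unfolding \<gamma>01[symmetric] N(3)[symmetric] by (simp_all add: L2_le_distr)
  \<comment> \<open>Two of the three slacks come from near-optimality of the couplings, the third
    from the mismatch at the junction.\<close>
  have "L2_le N (\<lambda>\<omega>. norm (fst (\<omega> 0) - snd (\<omega> 1))) ((W2 \<mu> \<nu> + e/3) + (e/3) + (W2 \<nu> \<rho> + e/3))"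
  proof (rule L2_le_AE_mono[OF L2_le_add[OF L2_le_add[OF L(1) N.L2_le_const] L(2)]])
    show "0 \<le> e/3" using e by simp
    show "AE \<omega> in N. \<bar>norm (fst (\<omega> 0) - snd (\<omega> 1))\<bar>
        \<le> norm (fst (\<omega> 0) - snd (\<omega> 0)) + e/3 + norm (fst (\<omega> 1) - snd (\<omega> 1))"
      using N(4)[of 0]
    proof eventually_elim
      case (elim \<omega>)
      then show ?case
        using dist_triangle[of "fst (\<omega> 0)" "snd (\<omega> 1)" "snd (\<omega> 0)"]
          dist_triangle[of "snd (\<omega> 0)" "snd (\<omega> 1)" "fst (\<omega> 1)"]
        by (simp add: dist_norm)
    qed
  qed measurable
  then have "W2 (distr N borel (\<lambda>\<omega>. fst (\<omega> 0))) (distr N borel (\<lambda>\<omega>. snd (\<omega> 1))) \<le> W2 \<mu> \<nu> + W2 \<nu> \<rho> + e"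
    by (intro W2_distr_le N(1)) (auto elim: back_subst[of "L2_le N _"])
  moreover have "distr N borel (\<lambda>\<omega>. fst (\<omega> 0)) = \<mu>"
    using couplingsD(3)[OF \<gamma>1(1)] distr_distr[of fst "borel \<Otimes>\<^sub>M borel" borel "\<lambda>\<omega>. \<omega> 0" N]
    by (simp add: N(3) \<gamma>01 comp_def)
  moreover have "distr N borel (\<lambda>\<omega>. snd (\<omega> 1)) = \<rho>"
    using couplingsD(4)[OF \<gamma>2(1)] distr_distr[of snd "borel \<Otimes>\<^sub>M borel" borel "\<lambda>\<omega>. \<omega> 1" N]
    by (simp add: N(3) \<gamma>01[simplified] comp_def)
  ultimately show "W2 \<mu> \<rho> \<le> W2 \<mu> \<nu> + W2 \<nu> \<rho> + e" by simp
qed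

section \<open>Completeness of the Wasserstein space\<close>

lemma (in prob_space) AE_convergent_of_summable_L2:
  fixes X :: "nat \<Rightarrow> 'a \<Rightarrow> 'b::euclidean_space"
  assumes L: "\<And>t. L2_le M (\<lambda>\<omega>. norm (X t \<omega> - X (Suc t) \<omega>)) (c t)" and c: "summable c"
  shows "AE \<omega> in M. convergent (\<lambda>t. X t \<omega>)"
proof -
  note [measurable] = L2_leD(1)[OF L]
  \<comment> \<open>The expected length of the path is bounded by the summed L2 norms of its
    increments, hence finite; almost every path has finite length and converges.\<close>
  have "(\<integral>\<^sup>+\<omega>. (\<Sum>t. ennreal (norm (X t \<omega> - X (Suc t) \<omega>))) \<partial>M) =
      (\<Sum>t. \<integral>\<^sup>+\<omega>. ennreal (norm (X t \<omega> - X (Suc t) \<omega>)) \<partial>M)"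
    by (rule nn_integral_suminf) measurable
  also have "\<dots> \<le> (\<Sum>t. ennreal (c t))"
    using L2_le_nn_integral[OF L] by (intro suminf_le) auto
  also have "\<dots> = ennreal (\<Sum>t. c t)"
    using c L2_leD(2)[OF L] by (intro suminf_ennreal2) auto
  finally have "(\<integral>\<^sup>+\<omega>. (\<Sum>t. ennreal (norm (X t \<omega> - X (Suc t) \<omega>))) \<partial>M) \<noteq> \<infinity>"
    by (auto simp: top_unique)
  then have "AE \<omega> in M. (\<Sum>t. ennreal (norm (X t \<omega> - X (Suc t) \<omega>))) \<noteq> \<infinity>"
    by (intro nn_integral_noteq_infinite) auto
  then show ?thesis
  proof eventually_elim
    case (elim \<omega>)
    then have "summable (\<lambda>t. norm (X t \<omega> - X (Suc t) \<omega>))"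
      by (intro summable_suminf_not_top) auto
    then have "summable (\<lambda>t. X (Suc t) \<omega> - X t \<omega>)"
      by (simp add: norm_minus_commute summable_norm_cancel)
    then have "convergent (\<lambda>n. X n \<omega> - X 0 \<omega>)"
      using sum_lessThan_telescope[of "\<lambda>n. X n \<omega>"] by (simp add: summable_iff_convergent)
    then have "convergent (\<lambda>n. (X n \<omega> - X 0 \<omega>) + X 0 \<omega>)"
      by (intro convergent_add convergent_const)
    then show ?case by simp
  qed
qed

text \<open>Completeness is inherited from L2: gluing realises all the measures as random variables
  on one space with summable increments, and the law of their pathwise limit is the limit
  measure.\<close>

lemma W2_complete:
  fixes \<mu> :: "nat \<Rightarrow> 'a::euclidean_space measure"
  assumes P: "\<And>t. \<mu> t \<in> P2" and b: "\<And>t. W2 (\<mu> t) (\<mu> (Suc t)) \<le> b t" "summable b"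
  obtains \<nu> where "\<nu> \<in> P2" "(\<lambda>t. W2 (\<mu> t) \<nu>) \<longlonglongrightarrow> 0"
proof -
  \<comment> \<open>The summable sequence \<open>h\<close> is used twice, as slack in choosing
    near-optimal couplings and as mesh in gluing them; this is why it is counted twice in
    \<open>c\<close>.\<close>
  define h :: "nat \<Rightarrow> real" where "h t = (1/2)^t" for t
  have h: "0 < h t" for t by (simp add: h_def)
  have "\<exists>\<gamma>. \<gamma> \<in> couplings (\<mu> t) (\<mu> (Suc t)) \<and> L2_le \<gamma> (\<lambda>z. norm (fst z - snd z)) (b t + h t)" for t
  proof -
    have "W2 (\<mu> t) (\<mu> (Suc t)) < b t + h t" using b(1)[of t] h[of t] by linarith
    then show ?thesis using coupling_W2_less[OF P P] by blast
  qed
  then obtain \<gamma> where \<gamma>: "\<And>t. \<gamma> t \<in> couplings (\<mu> t) (\<mu> (Suc t))"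
    "\<And>t. L2_le (\<gamma> t) (\<lambda>z. norm (fst z - snd z)) (b t + h t)" by metis
  obtain N where N: "prob_space N" "\<And>t. (\<lambda>\<omega>. \<omega> t) \<in> N \<rightarrow>\<^sub>M borel \<Otimes>\<^sub>M borel"
    "\<And>t. distr N (borel \<Otimes>\<^sub>M borel) (\<lambda>\<omega>. \<omega> t) = \<gamma> t"
    "\<And>t. AE \<omega> in N. dist (snd (\<omega> t)) (fst (\<omega> (Suc t))) < h t"
  proof (rule ex_glued_sequence[of \<gamma> h])
    show "\<gamma> t \<in> space (prob_algebra (borel \<Otimes>\<^sub>M borel))" for t
      using \<gamma>(1)[of t] by (simp add: couplings_def)
    show "distr (\<gamma> t) borel snd = distr (\<gamma> (Suc t)) borel fst" for t
      using couplingsD(3,4)[OF \<gamma>(1)] by simp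
  qed (use h in blast)+
  note [measurable] = N(2)
  interpret N: prob_space N by (rule N(1))
  define X where "X t \<omega> = fst (\<omega> t)" for t and \<omega> :: "nat \<Rightarrow> 'a \<times> 'a"
  have X[measurable]: "X t \<in> borel_measurable N" for t unfolding X_def by measurable
  have lawX: "distr N borel (X t) = \<mu> t" for t
    using couplingsD(3)[OF \<gamma>(1)[of t]] distr_distr[of fst "borel \<Otimes>\<^sub>M borel" borel "\<lambda>\<omega>. \<omega> t" N]
    by (simp add: N(3) comp_def X_def[abs_def])
  define c where "c t = (b t + h t) + h t" for t
  have step: "L2_le N (\<lambda>\<omega>. norm (X t \<omega> - X (Suc t) \<omega>)) (c t)" for t
  proof -
    have "L2_le N (\<lambda>\<omega>. norm (fst (\<omega> t) - snd (\<omega> t))) (b t + h t)"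
      using \<gamma>(2)[of t] unfolding N(3)[symmetric] by (simp add: L2_le_distr)
    from L2_le_add[OF this N.L2_le_const[of "h t"]]
    have L: "L2_le N (\<lambda>\<omega>. norm (fst (\<omega> t) - snd (\<omega> t)) + h t) (c t)"
      using h[of t] by (simp add: c_def)
    show ?thesis
    proof (rule L2_le_AE_mono[OF L])
      show "AE \<omega> in N. \<bar>norm (X t \<omega> - X (Suc t) \<omega>)\<bar> \<le> norm (fst (\<omega> t) - snd (\<omega> t)) + h t"
        using N(4)[of t]
      proof eventually_elim
        case (elim \<omega>)
        then show ?case
          using dist_triangle[of "fst (\<omega> t)" "fst (\<omega> (Suc t))" "snd (\<omega> t)"]
          by (simp add: dist_norm X_def)
      qed
    qed measurable
  qed
  have c0: "0 \<le> c t" for t using L2_leD(2)[OF step] .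
  have c: "summable c"
    unfolding c_def h_def using b(2) by (intro summable_add summable_geometric) auto
  have many: "L2_le N (\<lambda>\<omega>. norm (X t \<omega> - X (t + s) \<omega>)) (\<Sum>k<s. c (k + t))" for t s
  proof (induction s)
    case 0
    then show ?case using N.L2_le_const[of 0] by simp
  next
    case (Suc s)
    have "L2_le N (\<lambda>\<omega>. norm (X t \<omega> - X (t + s) \<omega>) + norm (X (t + s) \<omega> - X (Suc (t + s)) \<omega>))
        ((\<Sum>k<s. c (k + t)) + c (t + s))"
      by (rule L2_le_add[OF Suc step])
    then have "L2_le N (\<lambda>\<omega>. norm (X t \<omega> - X (t + Suc s) \<omega>)) ((\<Sum>k<s. c (k + t)) + c (t + s))"
    proof (rule L2_le_AE_mono)
      show "AE \<omega> in N. \<bar>norm (X t \<omega> - X (t + Suc s) \<omega>)\<bar> \<le>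
          norm (X t \<omega> - X (t + s) \<omega>) + norm (X (t + s) \<omega> - X (Suc (t + s)) \<omega>)"
        by (intro AE_I2) (simp add: dist_norm[symmetric] dist_triangle)
    qed measurable
    then show ?case by (simp add: add.commute)
  qed
  \<comment> \<open>On the null set of divergent paths \<open>lim\<close> is an unspecified value;
    \<open>Y\<close> is nevertheless measurable everywhere.\<close>
  define Y where "Y \<omega> = lim (\<lambda>t. X t \<omega>)" for \<omega>
  have Y[measurable]: "Y \<in> borel_measurable N" unfolding Y_def by measurable
  have lim: "AE \<omega> in N. (\<lambda>t. X t \<omega>) \<longlonglongrightarrow> Y \<omega>"
    using N.AE_convergent_of_summable_L2[OF step c] by (simp add: convergent_LIMSEQ_iff Y_def)
  \<comment> \<open>The finite-step bound \<open>many\<close> has partial sums of a tail as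
    constants; with the whole tail as common constant, \<open>s\<close> can be sent to
    infinity.\<close>
  have XY: "L2_le N (\<lambda>\<omega>. norm (X t \<omega> - Y \<omega>)) (\<Sum>k. c (k + t))" for t
  proof (rule L2_le_lim)
    show "L2_le N (\<lambda>\<omega>. norm (X t \<omega> - X (t + s) \<omega>)) (\<Sum>k. c (k + t))" for s
      by (rule L2_le_mono[OF many]) (intro sum_le_suminf summable_ignore_initial_segment c ballI c0 finite_lessThan)
    show "AE \<omega> in N. (\<lambda>s. norm (X t \<omega> - X (t + s) \<omega>)) \<longlonglongrightarrow> norm (X t \<omega> - Y \<omega>)"
      using lim
    proof eventually_elim
      case (elim \<omega>)
      then have "(\<lambda>s. X (s + t) \<omega>) \<longlonglongrightarrow> Y \<omega>" by (rule LIMSEQ_ignore_initial_segment)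
      then show ?case by (intro tendsto_norm tendsto_diff tendsto_const) (simp add: add.commute)
    qed
  qed measurable
  show ?thesis
  proof
    obtain B where "L2_le N (\<lambda>\<omega>. norm (X 0 \<omega>)) B"
      using P2_L2_le[OF N(1) X[of 0]] P lawX by auto
    from L2_le_add[OF this XY[of 0]]
    have "L2_le N (\<lambda>\<omega>. norm (Y \<omega>)) (B + (\<Sum>k. c (k + 0)))"
    proof (rule L2_le_AE_mono)
      show "AE \<omega> in N. \<bar>norm (Y \<omega>)\<bar> \<le> norm (X 0 \<omega>) + norm (X 0 \<omega> - Y \<omega>)"
        by (intro AE_I2) (metis abs_norm_cancel norm_minus_commute norm_triangle_sub)
    qed measurable
    then show "distr N borel Y \<in> P2"
      by (rule P2_distr[OF N(1) Y])
    show "(\<lambda>t. W2 (\<mu> t) (distr N borel Y)) \<longlonglongrightarrow> 0"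
    proof (rule tendsto_sandwich[OF _ _ tendsto_const])
      show "\<forall>\<^sub>F t in sequentially. W2 (\<mu> t) (distr N borel Y) \<le> (\<Sum>k. c (k + t))"
        using W2_distr_le[OF N(1) X Y XY] by (simp add: lawX)
      show "(\<lambda>t. \<Sum>k. c (k + t)) \<longlonglongrightarrow> 0"
        by (rule suminf_exist_split2[OF c])
    qed auto
  qed
qed

section \<open>Lipschitz test functions and separation of measures\<close>

lemma lipschitz_integral_W2:
  fixes f :: "'a::euclidean_space \<Rightarrow> real"
  assumes P: "\<mu> \<in> P2" "\<nu> \<in> P2" and f: "\<And>x y. \<bar>f x - f y\<bar> \<le> K * norm (x - y)"
    and bdd: "\<And>x. \<bar>f x\<bar> \<le> C" and K: "0 \<le> K" and m[measurable]: "f \<in> borel_measurable borel"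
  shows "\<bar>(\<integral>x. f x \<partial>\<mu>) - (\<integral>x. f x \<partial>\<nu>)\<bar> \<le> K * W2 \<mu> \<nu>"
proof -
  have "\<bar>(\<integral>x. f x \<partial>\<mu>) - (\<integral>x. f x \<partial>\<nu>)\<bar> \<le> K * B" if B: "W2 \<mu> \<nu> < B" for B
  proof -
    obtain \<gamma> where \<gamma>: "\<gamma> \<in> couplings \<mu> \<nu>" "L2_le \<gamma> (\<lambda>z. norm (fst z - snd z)) B"
      using coupling_W2_less[OF P B] .
    note c = couplingsD[OF \<gamma>(1)]
    interpret prob_space \<gamma> by (rule c(1))
    have i: "integrable \<gamma> (\<lambda>z. f (fst z))" "integrable \<gamma> (\<lambda>z. f (snd z))"
      by (rule integrable_const_bound[where B=C]; use bdd measurable_compose[OF c(5) m] measurable_compose[OF c(6) m] in simp)+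
    have n: "(\<lambda>z. norm (fst z - snd z)) \<in> borel_measurable \<gamma>" by (rule L2_leD(1)[OF \<gamma>(2)])
    \<comment> \<open>On a probability space the mean of the distance is at most its L2 norm; the
      Lipschitz estimate needs only the mean.\<close>
    have *: "(\<integral>\<^sup>+z. ennreal (norm (fst z - snd z)) \<partial>\<gamma>) \<le> ennreal B"
      using L2_le_nn_integral[OF \<gamma>(2)] by simp
    have ni: "integrable \<gamma> (\<lambda>z. norm (fst z - snd z))"
      using * n by (intro integrableI_bounded) (auto intro: le_less_trans)
    have nB: "(\<integral>z. norm (fst z - snd z) \<partial>\<gamma>) \<le> B"
      using * L2_leD(2)[OF \<gamma>(2)] n by (subst integral_eq_nn_integral) (auto intro: enn2real_leI)
    have "(\<integral>x. f x \<partial>\<mu>) - (\<integral>x. f x \<partial>\<nu>) = (\<integral>z. f (fst z) \<partial>\<gamma>) - (\<integral>z. f (snd z) \<partial>\<gamma>)"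
      using integral_distr[OF c(5) m] integral_distr[OF c(6) m] by (simp add: c)
    also have "\<dots> = (\<integral>z. f (fst z) - f (snd z) \<partial>\<gamma>)"
      using i by simp
    finally have "\<bar>(\<integral>x. f x \<partial>\<mu>) - (\<integral>x. f x \<partial>\<nu>)\<bar> \<le> (\<integral>z. \<bar>f (fst z) - f (snd z)\<bar> \<partial>\<gamma>)"
      using integral_abs_bound by metis
    also have "\<dots> \<le> (\<integral>z. K * norm (fst z - snd z) \<partial>\<gamma>)"
      using i ni f by (intro integral_mono) auto
    also have "\<dots> \<le> K * B" using nB K by (simp add: mult_left_mono)
    finally show ?thesis .
  qed
  then have "\<bar>(\<integral>x. f x \<partial>\<mu>) - (\<integral>x. f x \<partial>\<nu>)\<bar> \<le> K * (W2 \<mu> \<nu> + 1 / real (Suc n))" for n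
    by simp
  moreover have "(\<lambda>n. K * (W2 \<mu> \<nu> + 1 / real (Suc n))) \<longlonglongrightarrow> K * (W2 \<mu> \<nu> + 0)"
    by (intro tendsto_intros LIMSEQ_inverse_real_of_nat[unfolded inverse_eq_divide])
  ultimately show ?thesis
    by (intro LIMSEQ_le_const) auto
qed

text \<open>Lipschitz functions that decrease to the indicator of a nonempty closed set as
  \<open>k\<close> grows. Since \<open>infdist x {}\<close> is 0, the empty set yields the constant
  1 and is treated separately below.\<close>

definition cutoff :: "'a::euclidean_space set \<Rightarrow> nat \<Rightarrow> 'a \<Rightarrow> real" where
  "cutoff C k x = max 0 (1 - real k * infdist x C)"

lemma cutoff_bound: "\<bar>cutoff C k x\<bar> \<le> 1"
  using infdist_nonneg[of x C] by (simp add: cutoff_def)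

lemma cutoff_lipschitz: "\<bar>cutoff C k x - cutoff C k y\<bar> \<le> real k * norm (x - y)"
proof -
  have "\<bar>infdist x C - infdist y C\<bar> \<le> dist x y"
    using infdist_triangle_abs by blast
  then have "\<bar>real k * infdist x C - real k * infdist y C\<bar> \<le> real k * dist x y"
    by (simp add: right_diff_distrib[symmetric] abs_mult mult_left_mono)
  then show ?thesis by (auto simp: cutoff_def dist_norm max_def)
qed

lemma cutoff_measurable [measurable]: "cutoff C k \<in> borel_measurable borel"
  unfolding cutoff_def[abs_def]
  by (intro borel_measurable_continuous_onI continuous_intros)

lemma cutoff_tendsto:
  assumes "closed C" "C \<noteq> {}"
  shows "(\<lambda>k. cutoff C k x) \<longlonglongrightarrow> indicator C x"
proof (cases "x \<in> C")
  case True
  then show ?thesis by (simp add: cutoff_def)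
next
  case False
  then have pos: "0 < infdist x C"
    using assms in_closed_iff_infdist_zero infdist_nonneg by (metis less_eq_real_def)
  obtain n where n: "1 < real n * infdist x C" using reals_Archimedean3[OF pos] by blast
  have "cutoff C k x = 0" if "n \<le> k" for k
  proof -
    have "real n * infdist x C \<le> real k * infdist x C" using that pos by (intro mult_right_mono) auto
    then show ?thesis using n by (simp add: cutoff_def)
  qed
  then have "\<forall>\<^sub>F k in sequentially. cutoff C k x = 0" by (auto simp: eventually_sequentially)
  then show ?thesis using False by (simp add: tendsto_eventually)
qed

lemma cutoff_integral_tendsto:
  assumes "\<mu> \<in> P2" "closed C" "C \<noteq> {}"
  shows "(\<lambda>k. \<integral>x. cutoff C k x \<partial>\<mu>) \<longlonglongrightarrow> measure \<mu> C"
proof -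
  interpret prob_space \<mu> by (rule P2D(1)[OF assms(1)])
  note [measurable_cong] = P2D(2)[OF assms(1)]
  have C[measurable]: "C \<in> sets borel" using assms(2) by simp
  have "(\<lambda>k. \<integral>x. cutoff C k x \<partial>\<mu>) \<longlonglongrightarrow> (\<integral>x. indicator C x \<partial>\<mu>)"
    by (rule integral_dominated_convergence[where w="\<lambda>_. 1"])
      (use cutoff_bound cutoff_tendsto[OF assms(2,3)] in auto)
  then show ?thesis using P2D(3)[OF assms(1)] by simp
qed

lemma P2_eqI_closed:
  assumes P: "\<mu> \<in> P2" "\<nu> \<in> P2" and eq: "\<And>C. closed C \<Longrightarrow> C \<noteq> {} \<Longrightarrow> measure \<mu> C = measure \<nu> C"
  shows "\<mu> = \<nu>"
proof (rule measure_eqI_generator_eq[where E="Collect closed" and \<Omega>=UNIV and A="\<lambda>_. UNIV"])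
  interpret M: prob_space \<mu> by (rule P2D(1)[OF P(1)])
  interpret N: prob_space \<nu> by (rule P2D(1)[OF P(2)])
  show "Int_stable (Collect closed)" by (auto simp: Int_stable_def)
  show "sets \<mu> = sigma_sets UNIV (Collect closed)" "sets \<nu> = sigma_sets UNIV (Collect closed)"
    using P2D(2) P by (auto simp: borel_eq_closed)
  show "emeasure \<mu> C = emeasure \<nu> C" if "C \<in> Collect closed" for C
    using eq[of C] that by (cases "C = {}") (auto simp: M.emeasure_eq_measure N.emeasure_eq_measure)
  show "emeasure \<mu> UNIV \<noteq> \<infinity>" for i :: nat by (simp add: M.emeasure_eq_measure)
qed auto

text \<open>At distance zero all Lipschitz test integrals agree, and those of the cutoffs determine
  the mass of every closed set.\<close>

lemma W2_eq_0D:
  assumes P: "\<mu> \<in> P2" "\<nu> \<in> P2" and "W2 \<mu> \<nu> = 0"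
  shows "\<mu> = \<nu>"
proof (rule P2_eqI_closed[OF P])
  fix C :: "'a set" assume C: "closed C" "C \<noteq> {}"
  have "(\<integral>x. cutoff C k x \<partial>\<mu>) = (\<integral>x. cutoff C k x \<partial>\<nu>)" for k
    using lipschitz_integral_W2[OF P cutoff_lipschitz cutoff_bound, of k C] assms(3) by simp
  then show "measure \<mu> C = measure \<nu> C"
    using cutoff_integral_tendsto[OF P(1) C] cutoff_integral_tendsto[OF P(2) C] LIMSEQ_unique by simp
qed

section \<open>Recurring words in independent sequences\<close>

definition occurs :: "(nat \<Rightarrow> 'e) \<Rightarrow> nat \<Rightarrow> 'e list \<Rightarrow> bool" where
  "occurs e t w \<longleftrightarrow> (\<forall>j<length w. e (t + j) = w ! j)"

lemma occurs_append:
  "occurs e t (u @ w) \<longleftrightarrow> occurs e t u \<and> occurs e (t + length u) w"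
proof
  assume L: "occurs e t (u @ w)"
  have "e (t + j) = u ! j" if "j < length u" for j
    using L that by (auto simp: occurs_def nth_append dest!: spec[of _ j])
  moreover have "e (t + length u + j) = w ! j" if "j < length w" for j
    using L that by (auto simp: occurs_def nth_append add.assoc dest!: spec[of _ "length u + j"])
  ultimately show "occurs e t u \<and> occurs e (t + length u) w" by (simp add: occurs_def)
next
  assume R: "occurs e t u \<and> occurs e (t + length u) w"
  show "occurs e t (u @ w)"
    unfolding occurs_def
  proof (intro allI impI)
    fix j assume j: "j < length (u @ w)"
    show "e (t + j) = (u @ w) ! j"
    proof (cases "j < length u")
      case True
      then show ?thesis using R by (simp add: occurs_def nth_append)
    next
      case False
      then have "j - length u < length w" using j by auto
      then have "e (t + length u + (j - length u)) = w ! (j - length u)" using R unfolding occurs_def by blast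
      then show ?thesis using False by (simp add: nth_append)
    qed
  qed
qed

lemma occurs_Cons: "occurs e t (x # w) \<longleftrightarrow> e t = x \<and> occurs e (Suc t) w"
  using occurs_append[of e t "[x]" w] by (simp add: occurs_def)

lemma occurs_Nil [simp]: "occurs e t []"
  by (simp add: occurs_def)

lemma summable_power_div:
  fixes r :: real
  assumes "0 \<le> r" "r < 1" "0 < M"
  shows "summable (\<lambda>t. r ^ (t div M))"
proof -
  \<comment> \<open>\<open>r\<close> may be 0; enlarging it to at least 1/2 allows division by
    \<open>q\<close> in the comparison with powers of the M-th root of \<open>q\<close>.\<close>
  define q where "q = max r (1/2)"
  have q: "0 < q" "q < 1" "r \<le> q" using assms by (auto simp: q_def)
  define s where "s = root M q"
  have s: "0 < s" "s < 1" "s ^ M = q"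
    using q assms(3) by (auto simp: s_def)
  show ?thesis
  proof (rule summable_comparison_test)
    show "summable (\<lambda>t. s ^ t / q)"
      using s by (intro summable_divide summable_geometric) auto
    have "r ^ (t div M) \<le> s ^ t / q" for t
    proof -
      have "t \<le> M * (t div M) + M"
        using mult_div_mod_eq[of M t] mod_less_divisor[OF assms(3), of t] by linarith
      then have "s ^ (M * (t div M) + M) \<le> s ^ t" using s by (intro power_decreasing) auto
      then have "q ^ (t div M) * q \<le> s ^ t" by (simp add: power_add power_mult s)
      moreover have "r ^ (t div M) * q \<le> q ^ (t div M) * q"
        using assms q by (intro mult_right_mono power_mono) auto
      ultimately have "r ^ (t div M) * q \<le> s ^ t" by (rule order_trans[rotated])
      then show ?thesis using q by (simp add: pos_le_divide_eq)
    qed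
    then show "\<exists>N. \<forall>t\<ge>N. norm (r ^ (t div M)) \<le> s ^ t / q" using assms by auto
  qed
qed

lemma measurable_edge_selection_coord [measurable]:
  "(\<lambda>e. e t) \<in> edge_selection_law p \<rightarrow>\<^sub>M count_space UNIV"
proof -
  have "(\<lambda>e. e t) \<in> edge_selection_law p \<rightarrow>\<^sub>M measure_pmf p"
    unfolding edge_selection_law_def by (rule measurable_component_singleton) simp
  then show ?thesis by simp
qed

lemma space_edge_selection_law [simp]: "space (edge_selection_law p) = UNIV"
  by (simp add: edge_selection_law_def space_PiM)

lemma pred_edge_selection_eq [measurable]: "Measurable.pred (edge_selection_law p) (\<lambda>e. e t = x)"
  by (rule measurable_compose[OF measurable_edge_selection_coord, of "\<lambda>y. y = x"]) simp

lemma pred_occurs [measurable]: "Measurable.pred (edge_selection_law p) (\<lambda>e. occurs e t w)"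
  unfolding occurs_def by measurable

text \<open>A measurable majorant for the relative decrease of a contracting functional, which
  itself need not be measurable. The blocks start at multiples of \<open>length w\<close>, hence are
  disjoint and independent.\<close>

definition decay :: "real \<Rightarrow> 'e list \<Rightarrow> nat \<Rightarrow> (nat \<Rightarrow> 'e) \<Rightarrow> real" where
  "decay c w K e = (\<Prod>k<K. if occurs e (k * length w) w then c else 1)"

lemma measurable_decay [measurable]: "decay c w K \<in> borel_measurable (edge_selection_law p)"
  unfolding decay_def[abs_def] by measurable

lemma decay_nonneg: "0 < c \<Longrightarrow> 0 \<le> decay c w K e"
  unfolding decay_def by (intro prod_nonneg) auto

text \<open>\<open>comb_seq (length w) e e'\<close> takes its first block from \<open>e\<close> and
  everything later from \<open>e'\<close>, so the first factor depends on \<open>e\<close> alone and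
  the remaining ones on \<open>e'\<close> alone.\<close>

lemma decay_comb_seq:
  "decay c w (Suc K) (comb_seq (length w) e e') = (if occurs e 0 w then c else 1) * decay c w K e'"
proof -
  have "occurs (comb_seq (length w) e e') 0 w \<longleftrightarrow> occurs e 0 w"
    by (simp add: occurs_def comb_seq_less)
  moreover have "occurs (comb_seq (length w) e e') (Suc k * length w) w \<longleftrightarrow> occurs e' (k * length w) w" for k
  proof -
    have "comb_seq (length w) e e' (Suc k * length w + j) = e' (k * length w + j)" for j
      using comb_seq_add[of "length w" e e' "k * length w + j"] by (simp add: ac_simps)
    then show ?thesis unfolding occurs_def by metis
  qed
  ultimately show ?thesis
    by (simp add: decay_def prod.lessThan_Suc_shift del: prod.lessThan_Suc)
qed

lemma prob_space_edge_selection_law: "prob_space (edge_selection_law p)"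
  unfolding edge_selection_law_def by (intro prob_space_PiM measure_pmf.prob_space_axioms)

text \<open>Splicing two independent copies of the edge sequence after \<open>length w\<close> steps
  reproduces its law; so one factor splits off the expectation at each induction step.\<close>

lemma nn_integral_decay:
  assumes "0 < c"
  shows "(\<integral>\<^sup>+e. ennreal (decay c w K e) \<partial>edge_selection_law p) =
    (\<integral>\<^sup>+e. ennreal (if occurs e 0 w then c else 1) \<partial>edge_selection_law p) ^ K"
proof (induction K)
  case 0
  interpret prob_space "edge_selection_law p" by (rule prob_space_edge_selection_law)
  show ?case using emeasure_space_1 by (simp add: decay_def)
next
  case (Suc K)
  let ?S = "edge_selection_law p"
  interpret SS: sequence_space "measure_pmf p" ..
  interpret prob_space ?S by (rule prob_space_edge_selection_law)
  have comb: "?S = distr (?S \<Otimes>\<^sub>M ?S) ?S (\<lambda>(e, e'). comb_seq (length w) e e')"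
    unfolding edge_selection_law_def using SS.PiM_comb_seq[symmetric] .
  have m: "(\<lambda>(e, e'). comb_seq (length w) e e') \<in> ?S \<Otimes>\<^sub>M ?S \<rightarrow>\<^sub>M ?S"
    unfolding edge_selection_law_def by (rule measurable_comb_seq)
  have "(\<integral>\<^sup>+e. ennreal (decay c w (Suc K) e) \<partial>?S) =
      (\<integral>\<^sup>+z. ennreal (decay c w (Suc K) ((\<lambda>(e, e'). comb_seq (length w) e e') z)) \<partial>(?S \<Otimes>\<^sub>M ?S))"
    by (subst comb, rule nn_integral_distr[OF m]) measurable
  also have "\<dots> = (\<integral>\<^sup>+z. ennreal (if occurs (fst z) 0 w then c else 1) * ennreal (decay c w K (snd z)) \<partial>(?S \<Otimes>\<^sub>M ?S))"
    using assms by (intro nn_integral_cong) (auto simp: decay_comb_seq ennreal_mult decay_nonneg)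
  also have "\<dots> = (\<integral>\<^sup>+e. (\<integral>\<^sup>+e'. ennreal (if occurs e 0 w then c else 1) * ennreal (decay c w K e') \<partial>?S) \<partial>?S)"
    by (subst nn_integral_fst[symmetric]) auto
  also have "\<dots> = (\<integral>\<^sup>+e. ennreal (if occurs e 0 w then c else 1) \<partial>?S) * (\<integral>\<^sup>+e'. ennreal (decay c w K e') \<partial>?S)"
    by (simp add: nn_integral_cmult nn_integral_multc)
  finally show ?case by (simp add: Suc)
qed

lemma emeasure_occurs_pos:
  assumes "set w \<subseteq> set_pmf p"
  shows "0 < emeasure (edge_selection_law p) {e. occurs e 0 w}"
proof -
  interpret sequence_space "measure_pmf p" ..
  have "{e. occurs e 0 w} = {e\<in>space (edge_selection_law p). \<forall>i\<in>{..<length w}. e i \<in> {w ! i}}"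
    by (auto simp: occurs_def)
  also have "emeasure (edge_selection_law p) \<dots> = (\<Prod>i<length w. emeasure (measure_pmf p) {w ! i})"
    unfolding edge_selection_law_def by (rule emeasure_PiM_Collect) auto
  also have "\<dots> \<noteq> 0"
    using assms by (auto simp: emeasure_pmf_single set_pmf_iff subset_iff)
  finally show ?thesis by (simp add: zero_less_iff_neq_zero)
qed

text \<open>Here \<open>r\<close> is 1 - (1 - c) P, with P > 0 the probability that a block equals
  \<open>w\<close>.\<close>

lemma nn_integral_decay_factor:
  assumes "0 < c" "c < 1" "set w \<subseteq> set_pmf p"
  obtains r where "0 \<le> r" "r < 1"
    "(\<integral>\<^sup>+e. ennreal (if occurs e 0 w then c else 1) \<partial>edge_selection_law p) = ennreal r"
proof -
  let ?S = "edge_selection_law p"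
  interpret prob_space ?S by (rule prob_space_edge_selection_law)
  let ?A = "{e. occurs e 0 w}"
  have A[measurable]: "?A \<in> sets ?S" using pred_occurs[of 0 w p] by (simp add: pred_def)
  have pos: "0 < prob ?A"
    using emeasure_occurs_pos[OF assms(3)] by (simp add: emeasure_eq_measure)
  have "(\<integral>\<^sup>+e. ennreal (if occurs e 0 w then c else 1) \<partial>?S) =
      (\<integral>\<^sup>+e. ennreal c * indicator ?A e + indicator (UNIV - ?A) e \<partial>?S)"
    by (intro nn_integral_cong) (auto simp: indicator_def)
  also have "\<dots> = ennreal c * emeasure ?S ?A + emeasure ?S (UNIV - ?A)"
    using A sets.compl_sets[OF A] by (subst nn_integral_add) (auto simp: nn_integral_cmult)
  also have "emeasure ?S (UNIV - ?A) = ennreal (1 - prob ?A)"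
    using prob_compl[OF A] by (simp add: emeasure_eq_measure)
  also have "ennreal c * emeasure ?S ?A + ennreal (1 - prob ?A) = ennreal (c * prob ?A + (1 - prob ?A))"
    using assms by (simp add: emeasure_eq_measure ennreal_mult)
  finally show ?thesis
  proof (rule that[rotated 2])
    show "0 \<le> c * prob ?A + (1 - prob ?A)" using assms by simp
    show "c * prob ?A + (1 - prob ?A) < 1" using pos assms by simp
  qed
qed

text \<open>The expectations are geometric in the number of completed blocks, so the series has
  finite mean. Summability, and not just convergence to 0, is needed to make the agents' paths
  Cauchy.\<close>

lemma AE_decay_summable:
  assumes "0 < c" "c < 1" "set w \<subseteq> set_pmf p" "w \<noteq> []"
  shows "AE e in edge_selection_law p. (\<Sum>t. ennreal (decay c w (t div length w) e)) \<noteq> \<infinity>"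
proof (rule nn_integral_noteq_infinite)
  let ?S = "edge_selection_law p"
  obtain r where r: "0 \<le> r" "r < 1"
    "(\<integral>\<^sup>+e. ennreal (if occurs e 0 w then c else 1) \<partial>?S) = ennreal r"
    using nn_integral_decay_factor[OF assms(1-3)] .
  have "(\<integral>\<^sup>+e. (\<Sum>t. ennreal (decay c w (t div length w) e)) \<partial>?S) =
      (\<Sum>t. \<integral>\<^sup>+e. ennreal (decay c w (t div length w) e) \<partial>?S)"
    by (rule nn_integral_suminf) measurable
  also have "\<dots> = (\<Sum>t. ennreal (r ^ (t div length w)))"
    using r(1) by (simp add: nn_integral_decay[OF assms(1)] r(3) ennreal_power)
  also have "\<dots> = ennreal (\<Sum>t. r ^ (t div length w))"
    using r assms(4) by (intro suminf_ennreal2 summable_power_div) auto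
  finally show "(\<integral>\<^sup>+e. (\<Sum>t. ennreal (decay c w (t div length w) e)) \<partial>?S) \<noteq> \<infinity>" by simp
qed measurable

section \<open>Almost sure convergence of contracting processes\<close>

lemma P2_return_0: "return borel (0::'a::euclidean_space) \<in> P2"
proof -
  interpret prob_space "return borel (0::'a)" by (rule prob_space_return) simp
  have "return borel (0::'a) \<in> space (prob_algebra borel)"
    using prob_space_axioms by (simp add: space_prob_algebra)
  then show ?thesis by (simp add: P2_def nn_integral_return)
qed

text \<open>Closed sets form an intersection-stable generator, so their masses suffice. The mass of
  a closed set is an iterated limit: over \<open>t\<close> by convergence in \<open>W2\<close>,
  which controls Lipschitz integrals, and then over the sharpness \<open>k\<close> of the
  cutoff.\<close>

lemma measurable_P2_limit:
  fixes \<nu> :: "'b \<Rightarrow> 'a::euclidean_space measure"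
  assumes P: "\<And>e. e \<in> space M \<Longrightarrow> \<nu> e \<in> P2" "\<And>e t. e \<in> space M \<Longrightarrow> \<mu> e t \<in> P2"
    and lim: "\<And>e. e \<in> space M \<Longrightarrow> (\<lambda>t. W2 (\<mu> e t) (\<nu> e)) \<longlonglongrightarrow> 0"
    and meas: "\<And>C k t. (\<lambda>e. \<integral>x. cutoff C k x \<partial>\<mu> e t) \<in> borel_measurable M"
  shows "\<nu> \<in> M \<rightarrow>\<^sub>M prob_algebra borel"
proof (rule measurable_prob_algebraI)
  show "prob_space (\<nu> e)" if "e \<in> space M" for e using P2D(1) P(1)[OF that] .
  show "\<nu> \<in> M \<rightarrow>\<^sub>M subprob_algebra borel"
  proof (rule measurable_subprob_algebra_generated[where G="Collect closed" and \<Omega>=UNIV])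
    show "sets borel = sigma_sets UNIV (Collect closed :: 'a set set)" by (simp add: borel_eq_closed)
    show "Int_stable (Collect closed :: 'a set set)" by (auto simp: Int_stable_def)
    show "subprob_space (\<nu> e)" if "e \<in> space M" for e
      using P2D(1)[OF P(1)[OF that]] by (simp add: prob_space_imp_subprob_space)
    show "sets (\<nu> e) = sets borel" if "e \<in> space M" for e
      using P2D(2)[OF P(1)[OF that]] .
    show closed: "(\<lambda>e. emeasure (\<nu> e) C) \<in> borel_measurable M" if "C \<in> Collect closed" for C :: "'a set"
    proof (cases "C = {}")
      case False
      have "(\<lambda>e. measure (\<nu> e) C) \<in> borel_measurable M"
      proof (rule borel_measurable_LIMSEQ_real)
        show "(\<lambda>k. \<integral>x. cutoff C k x \<partial>\<nu> e) \<longlonglongrightarrow> measure (\<nu> e) C" if "e \<in> space M" for e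
          using cutoff_integral_tendsto[OF P(1)[OF that]] \<open>C \<in> Collect closed\<close> False by simp
        show "(\<lambda>e. \<integral>x. cutoff C k x \<partial>\<nu> e) \<in> borel_measurable M" for k
        proof (rule borel_measurable_LIMSEQ_real)
          show "(\<lambda>e. \<integral>x. cutoff C k x \<partial>\<mu> e t) \<in> borel_measurable M" for t by (rule meas)
          show "(\<lambda>t. \<integral>x. cutoff C k x \<partial>\<mu> e t) \<longlonglongrightarrow> (\<integral>x. cutoff C k x \<partial>\<nu> e)" if e: "e \<in> space M" for e
          proof (rule Lim_null[THEN iffD2], rule Lim_null_comparison)
            show "\<forall>\<^sub>F t in sequentially. norm ((\<integral>x. cutoff C k x \<partial>\<mu> e t) - (\<integral>x. cutoff C k x \<partial>\<nu> e))
                \<le> real k * W2 (\<mu> e t) (\<nu> e)"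
              using lipschitz_integral_W2[OF P(2)[OF e] P(1)[OF e] cutoff_lipschitz cutoff_bound] by simp
            show "(\<lambda>t. real k * W2 (\<mu> e t) (\<nu> e)) \<longlonglongrightarrow> 0"
              using tendsto_mult_right_zero[OF lim[OF e]] by simp
          qed
        qed
      qed
      moreover have "emeasure (\<nu> e) C = ennreal (measure (\<nu> e) C)" if "e \<in> space M" for e
        using finite_measure.emeasure_eq_measure[OF prob_space.finite_measure[OF P2D(1)[OF P(1)[OF that]]]] .
      ultimately show ?thesis by (simp cong: measurable_cong)
    qed simp
    show "(\<lambda>e. emeasure (\<nu> e) UNIV) \<in> borel_measurable M" by (rule closed) simp
  qed simp
qed

text \<open>The edge type may be uncountable, so a function of a prefix of \<open>e\<close> need not be measurable before
  \<open>e\<close> is retracted to the finite support of \<open>p\<close>.\<close>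

definition retract :: "'e pmf \<Rightarrow> (nat \<Rightarrow> 'e) \<Rightarrow> nat \<Rightarrow> 'e" where
  "retract p e t = (if e t \<in> set_pmf p then e t else (SOME x. x \<in> set_pmf p))"

lemma retract_in: "retract p e t \<in> set_pmf p"
  using someI_ex[of "\<lambda>x. x \<in> set_pmf p"] set_pmf_not_empty[of p] by (auto simp: retract_def)

lemma retract_eq: "range e \<subseteq> set_pmf p \<Longrightarrow> retract p e = e"
  by (auto simp: retract_def fun_eq_iff)

text \<open>After retraction the first \<open>t\<close> edges form a list over a finite set. Every
  function of such a list is measurable, however irregular, which covers arbitrary selections of
  optimal plans.\<close>

lemma measurable_prefix_function:
  assumes fin: "finite (set_pmf p)" and H: "\<And>e e'. (\<And>s. s < t \<Longrightarrow> e s = e' s) \<Longrightarrow> H e = H e'"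
    and sp: "\<And>e. H e \<in> space N"
  shows "(\<lambda>e. H (retract p e)) \<in> edge_selection_law p \<rightarrow>\<^sub>M N"
proof -
  let ?I = "{l. set l \<subseteq> set_pmf p \<and> length l = t}"
  have I: "countable ?I" using finite_lists_length_eq[OF fin] by (rule countable_finite)
  have "(\<lambda>e. map (retract p e) [0..<t]) \<in> edge_selection_law p \<rightarrow>\<^sub>M count_space ?I"
    unfolding measurable_count_space_eq_countable[OF I]
  proof (intro conjI ballI funcsetI)
    show "map (retract p e) [0..<t] \<in> ?I" for e using retract_in[of p e] by auto
    fix l assume l: "l \<in> ?I"
    have coord: "Measurable.pred (edge_selection_law p) (\<lambda>e. retract p e s = x)" for s x
    proof -
      have "Measurable.pred (count_space UNIV) (\<lambda>y. (if y \<in> set_pmf p then y else (SOME x. x \<in> set_pmf p)) = x)"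
        by (rule measurable_count_space)
      from measurable_compose[OF measurable_edge_selection_coord this] show ?thesis
        unfolding retract_def .
    qed
    have "map f [0..<t] = l \<longleftrightarrow> (\<forall>s<t. f s = l ! s)" for f
      using l by (simp add: list_eq_iff_nth_eq)
    then have "(\<lambda>e. map (retract p e) [0..<t]) -` {l} \<inter> space (edge_selection_law p) =
        {e \<in> space (edge_selection_law p). \<forall>s\<in>{..<t}. retract p e s = l ! s}"
      by (auto simp: vimage_def)
    also have "\<dots> \<in> sets (edge_selection_law p)"
      by (intro sets.sets_Collect_finite_All coord[unfolded pred_def]) simp
    finally show "(\<lambda>e. map (retract p e) [0..<t]) -` {l} \<inter> space (edge_selection_law p)
        \<in> sets (edge_selection_law p)" .
  qed
  \<comment> \<open>The sequence \<open>(!) l\<close> is unspecified beyond position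
    \<open>t\<close>, where \<open>H\<close> does not look.\<close>
  then have "(\<lambda>e. H (\<lambda>s. map (retract p e) [0..<t] ! s)) \<in> edge_selection_law p \<rightarrow>\<^sub>M N"
    by (rule measurable_compose[where g="\<lambda>l. H ((!) l)"]) (use sp in simp)
  moreover have "H (\<lambda>s. map (retract p e) [0..<t] ! s) = H (retract p e)" for e
    by (rule H) simp
  ultimately show ?thesis by simp
qed

text \<open>\<open>S\<close> acts as a Lyapunov function that bounds both the diameter of the
  configuration and the length of the next move. The hypotheses concern only sequences inside the
  support of \<open>p\<close>: the others have probability zero, and along them the measures may
  leave \<open>P2\<close>.\<close>

theorem reaches_random_consensus_if_contracting:
  fixes X :: "(nat \<Rightarrow> 'e) \<Rightarrow> nat \<Rightarrow> 'v \<Rightarrow> 'a::euclidean_space measure"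
    and S :: "(nat \<Rightarrow> 'e) \<Rightarrow> nat \<Rightarrow> real"
  assumes V: "V \<noteq> {}" and fin: "finite (set_pmf p)"
    and init: "\<And>e. X e 0 = \<mu>0"
    and adapted: "\<And>e e' t. (\<And>s. s < t \<Longrightarrow> e s = e' s) \<Longrightarrow> X e t = X e' t"
    and P2: "\<And>e t i. range e \<subseteq> set_pmf p \<Longrightarrow> i \<in> V \<Longrightarrow> X e t i \<in> P2"
    and diam: "\<And>e t i j. range e \<subseteq> set_pmf p \<Longrightarrow> i \<in> V \<Longrightarrow> j \<in> V \<Longrightarrow> W2 (X e t i) (X e t j) \<le> S e t"
    and move: "\<And>e t i. range e \<subseteq> set_pmf p \<Longrightarrow> i \<in> V \<Longrightarrow> W2 (X e t i) (X e (Suc t) i) \<le> S e t"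
    and decr: "\<And>e t. range e \<subseteq> set_pmf p \<Longrightarrow> S e (Suc t) \<le> S e t"
    and contract: "\<And>e t. range e \<subseteq> set_pmf p \<Longrightarrow> occurs e t w \<Longrightarrow> S e (t + length w) \<le> c * S e t"
    and zero: "\<And>e. range e \<subseteq> set_pmf p \<Longrightarrow> (\<forall>i\<in>V. \<forall>j\<in>V. \<mu>0 i = \<mu>0 j) \<Longrightarrow> S e 0 \<le> 0"
    and w: "set w \<subseteq> set_pmf p" "w \<noteq> []" and c: "0 < c" "c < 1"
  shows "reaches_random_consensus V (edge_selection_law p) \<mu>0 X"
proof -
  let ?L = "edge_selection_law p"
  let ?D = "\<lambda>t e. decay c w (t div length w) e"
  obtain v where v: "v \<in> V" using V by blast
  have S_nonneg: "0 \<le> S e t" if "range e \<subseteq> set_pmf p" for e t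
    using diam[OF that v v, of t] W2_nonneg order_trans by blast
  have S_anti: "S e t' \<le> S e t" if e: "range e \<subseteq> set_pmf p" and "t \<le> t'" for e t t'
    using \<open>t \<le> t'\<close> by (induction rule: dec_induct) (auto intro: order_trans[OF decr[OF e]])
  have S_block: "S e (K * length w) \<le> decay c w K e * S e 0" if e: "range e \<subseteq> set_pmf p" for e K
  proof (induction K)
    case 0
    then show ?case by (simp add: decay_def)
  next
    case (Suc K)
    have "S e (K * length w + length w) \<le> (if occurs e (K * length w) w then c else 1) * S e (K * length w)"
      using contract[OF e] S_anti[OF e, of "K * length w" "K * length w + length w"] by simp
    also have "\<dots> \<le> (if occurs e (K * length w) w then c else 1) * (decay c w K e * S e 0)"
      using c by (intro mult_left_mono Suc) auto
    also have "\<dots> = decay c w (Suc K) e * S e 0" by (simp add: decay_def)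
    finally show ?case by (simp add: add.commute)
  qed
  have S_le: "S e t \<le> ?D t e * S e 0" if e: "range e \<subseteq> set_pmf p" for e t
    using S_anti[OF e, of "(t div length w) * length w" t] S_block[OF e, of "t div length w"] by simp
  \<comment> \<open>A measurable event of full probability on which every pathwise argument below
    holds without exception.\<close>
  define G where "G e \<longleftrightarrow> (\<Sum>t. ennreal (?D t e)) \<noteq> \<infinity> \<and> (\<forall>s. e s \<in> set_pmf p)" for e
  have pred_G[measurable]: "Measurable.pred ?L G"
  proof -
    have coord: "Measurable.pred ?L (\<lambda>e. e s \<in> set_pmf p)" for s
      by (rule measurable_compose[OF measurable_edge_selection_coord, of "\<lambda>y. y \<in> set_pmf p"]) simp
    show ?thesis unfolding G_def[abs_def] using coord by measurable
  qed
  have AE_G: "AE e in ?L. G e"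
  proof -
    have "AE e in ?L. e s \<in> set_pmf p" for s
      unfolding edge_selection_law_def
      by (rule AE_PiM_component) (auto simp: measure_pmf.prob_space_axioms AE_measure_pmf)
    then have "AE e in ?L. \<forall>s. e s \<in> set_pmf p" by (simp add: AE_all_countable)
    with AE_decay_summable[OF c w] show ?thesis unfolding G_def by eventually_elim auto
  qed
  have S_summable: "summable (S e)" if "G e" for e
  proof (rule summable_comparison_test)
    have e: "range e \<subseteq> set_pmf p" using that by (auto simp: G_def)
    have "summable (\<lambda>t. ?D t e)"
      using that c(1) by (intro summable_suminf_not_top decay_nonneg) (auto simp: G_def)
    then show "summable (\<lambda>t. ?D t e * S e 0)" by (rule summable_mult2)
    show "\<exists>N. \<forall>t\<ge>N. norm (S e t) \<le> ?D t e * S e 0"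
      using S_le[OF e] S_nonneg[OF e] by auto
  qed
  define good_limit where "good_limit e \<nu> \<longleftrightarrow> \<nu> \<in> P2 \<and> (\<lambda>t. W2 (X e t v) \<nu>) \<longlonglongrightarrow> 0" for e \<nu>
  \<comment> \<open>A Dirac mass off \<open>G\<close> keeps all values in \<open>P2\<close>, as the
    definition of consensus demands for every sequence. Measurability of the choice on
    \<open>G\<close> follows because its value is a \<open>W2\<close> limit.\<close>
  define \<mu>inf where "\<mu>inf e = (if G e then (SOME \<nu>. good_limit e \<nu>) else return borel 0)" for e
  have lim: "good_limit e (\<mu>inf e)" if G: "G e" for e
  proof -
    have e: "range e \<subseteq> set_pmf p" using G by (auto simp: G_def)
    have "\<exists>\<nu>. good_limit e \<nu>"
      using W2_complete[of "\<lambda>t. X e t v" "S e", OF P2[OF e v] move[OF e v] S_summable[OF G]]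
      unfolding good_limit_def by blast
    then have "good_limit e (SOME \<nu>. good_limit e \<nu>)" by (rule someI_ex)
    then show ?thesis using G by (simp add: \<mu>inf_def)
  qed
  have P2_inf: "\<mu>inf e \<in> P2" for e
    using lim[of e] P2_return_0 by (cases "G e") (simp_all add: good_limit_def[of e "\<mu>inf e"], simp add: \<mu>inf_def)
  have "\<mu>inf \<in> ?L \<rightarrow>\<^sub>M prob_algebra borel"
  proof (rule measurable_P2_limit)
    \<comment> \<open>Using the same default off \<open>G\<close> makes the approximations converge
      everywhere; on \<open>G\<close> the retraction is the identity, so they are the true measures
      of agent \<open>v\<close>.\<close>
    define \<mu> where "\<mu> e t = (if G e then X (retract p e) t v else return borel 0)" for e t
    show "\<mu> e t \<in> P2" for e t
      using P2[of "retract p e" v t] v retract_in[of p e] P2_return_0 by (auto simp: \<mu>_def)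
    show "(\<lambda>t. W2 (\<mu> e t) (\<mu>inf e)) \<longlonglongrightarrow> 0" for e
    proof (cases "G e")
      case True
      then have "retract p e = e" by (intro retract_eq) (auto simp: G_def)
      with lim[OF True] show ?thesis using True by (simp add: \<mu>_def good_limit_def[of e "\<mu>inf e"])
    next
      case False
      then show ?thesis using W2_refl[OF P2_return_0[where 'a='a]] by (simp add: \<mu>_def \<mu>inf_def)
    qed
    show "(\<lambda>e. \<integral>x. cutoff C k x \<partial>\<mu> e t) \<in> borel_measurable ?L" for C k t
    proof -
      have [measurable]: "(\<lambda>e. \<integral>x. cutoff C k x \<partial>X (retract p e) t v) \<in> borel_measurable ?L"
        using fin by (rule measurable_prefix_function[where t=t and H="\<lambda>e. \<integral>x. cutoff C k x \<partial>X e t v"])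
          (auto intro: adapted arg_cong[of _ _ "\<lambda>Z. \<integral>x. cutoff C k x \<partial>Z v"])
      have "(\<lambda>e. \<integral>x. cutoff C k x \<partial>\<mu> e t) =
          (\<lambda>e. if G e then \<integral>x. cutoff C k x \<partial>X (retract p e) t v else \<integral>x. cutoff C k x \<partial>return borel 0)"
        by (simp add: \<mu>_def fun_eq_iff)
      also have "\<dots> \<in> borel_measurable ?L" by measurable
      finally show ?thesis .
    qed
  qed (rule P2_inf)
  moreover have conv: "(\<lambda>t. W2 (X e t i) (\<mu>inf e)) \<longlonglongrightarrow> 0" if G: "G e" and i: "i \<in> V" for e i
  proof (rule Lim_null_comparison)
    have e: "range e \<subseteq> set_pmf p" using G by (auto simp: G_def)
    have "W2 (X e t i) (\<mu>inf e) \<le> S e t + W2 (X e t v) (\<mu>inf e)" for t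
      using W2_triangle[OF P2[OF e i, of t] P2[OF e v, of t] P2_inf[of e]] diam[OF e i v, of t] by linarith
    then show "\<forall>\<^sub>F t in sequentially. norm (W2 (X e t i) (\<mu>inf e)) \<le> S e t + W2 (X e t v) (\<mu>inf e)"
      by simp
    show "(\<lambda>t. S e t + W2 (X e t v) (\<mu>inf e)) \<longlonglongrightarrow> 0"
      using tendsto_add[OF summable_LIMSEQ_zero[OF S_summable[OF G]]] lim[OF G] by (simp add: good_limit_def)
  qed
  moreover have "\<mu>inf e = \<mu>0 i" if G: "G e" and i: "i \<in> V" and eq: "\<forall>i\<in>V. \<forall>j\<in>V. \<mu>0 i = \<mu>0 j" for e i
  proof -
    have e: "range e \<subseteq> set_pmf p" using G by (auto simp: G_def)
    \<comment> \<open>With equal initial measures \<open>S\<close> starts at 0 and stays there, so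
      every move has length 0 and the process is frozen.\<close>
    have S0: "S e t = 0" for t
      using zero[OF e eq] S_anti[OF e, of 0 t] S_nonneg[OF e, of t] by simp
    have "X e t i = \<mu>0 i" for t
    proof (induction t)
      case (Suc t)
      have "W2 (X e t i) (X e (Suc t) i) = 0"
        using move[OF e i, of t] S0[of t] W2_nonneg[of "X e t i" "X e (Suc t) i"] by linarith
      then show ?case using W2_eq_0D[OF P2[OF e i] P2[OF e i]] Suc by metis
    qed (simp add: init)
    then have "(\<lambda>t::nat. W2 (\<mu>0 i) (\<mu>inf e)) \<longlonglongrightarrow> 0" using conv[OF G i] by simp
    then have "W2 (\<mu>0 i) (\<mu>inf e) = 0" by (simp add: LIMSEQ_const_iff)
    moreover have "\<mu>0 i \<in> P2" using P2[OF e i, of 0] by (simp add: init)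
    ultimately show ?thesis using W2_eq_0D P2_inf by metis
  qed
  ultimately have "(AE e in ?L. \<forall>i\<in>V. (\<lambda>t. W2 (X e t i) (\<mu>inf e)) \<longlonglongrightarrow> 0)"
    "(\<forall>i\<in>V. \<forall>j\<in>V. \<mu>0 i = \<mu>0 j) \<longrightarrow> (AE e in ?L. \<forall>i\<in>V. \<mu>inf e = \<mu>0 i)"
    "\<mu>inf \<in> ?L \<rightarrow>\<^sub>M prob_algebra borel"
    using AE_G by (blast intro: AE_mp[OF _ AE_I2])+
  then show ?thesis
    unfolding reaches_random_consensus_def using P2_inf by blast
qed

section \<open>Gaps along cycles and lines\<close>

lemma W2_chain:
  assumes "k \<le> l" "\<And>m. k \<le> m \<Longrightarrow> m \<le> l \<Longrightarrow> Y m \<in> P2"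
  shows "W2 (Y k) (Y l) \<le> (\<Sum>m=k..<l. W2 (Y m) (Y (Suc m)))"
  using assms
proof (induction l rule: dec_induct)
  case base
  then show ?case by (simp add: W2_refl)
next
  case (step l)
  have "W2 (Y k) (Y (Suc l)) \<le> W2 (Y k) (Y l) + W2 (Y l) (Y (Suc l))"
    using step by (intro W2_triangle) auto
  with step show ?case by simp
qed

lemma W2_chain_diam:
  assumes "i \<in> {1..n}" "j \<in> {1..n}" and Y: "\<And>m. m \<in> {1..n} \<Longrightarrow> Y m \<in> P2"
  shows "W2 (Y i) (Y j) \<le> (\<Sum>m=1..<n. W2 (Y m) (Y (Suc m)))"
proof -
  have *: "W2 (Y k) (Y l) \<le> (\<Sum>m=1..<n. W2 (Y m) (Y (Suc m)))" if "k \<le> l" "k \<in> {1..n}" "l \<in> {1..n}" for k l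
  proof -
    have "W2 (Y k) (Y l) \<le> (\<Sum>m=k..<l. W2 (Y m) (Y (Suc m)))"
      using that Y by (intro W2_chain) auto
    also have "\<dots> \<le> (\<Sum>m=1..<n. W2 (Y m) (Y (Suc m)))"
      using that by (intro sum_mono2) auto
    finally show ?thesis .
  qed
  show ?thesis
    using *[of i j] *[of j i] assms W2_commute[OF Y Y, of i j] by (cases "i \<le> j") auto
qed

lemma directed_pawbar_adapted:
  "(\<And>s. s < t \<Longrightarrow> e s = e' s) \<Longrightarrow> directed_pawbar \<gamma>opt a \<mu>0 e t = directed_pawbar \<gamma>opt a \<mu>0 e' t"
proof (induction t)
  case (Suc t)
  then have "directed_pawbar \<gamma>opt a \<mu>0 e t = directed_pawbar \<gamma>opt a \<mu>0 e' t" by simp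
  moreover have "map e [0..<Suc t] = map e' [0..<Suc t]" using Suc.prems by (intro map_cong) auto
  moreover have "e t = e' t" using Suc.prems by simp
  ultimately show ?case unfolding directed_pawbar.simps by presburger
qed simp

lemma symmetric_pawbar_adapted:
  "(\<And>s. s < t \<Longrightarrow> e s = e' s) \<Longrightarrow> symmetric_pawbar \<gamma>opt \<mu>0 e t = symmetric_pawbar \<gamma>opt \<mu>0 e' t"
proof (induction t)
  case (Suc t)
  then have "symmetric_pawbar \<gamma>opt \<mu>0 e t = symmetric_pawbar \<gamma>opt \<mu>0 e' t" by simp
  moreover have "map e [0..<Suc t] = map e' [0..<Suc t]" using Suc.prems by (intro map_cong) auto
  moreover have "e t = e' t" using Suc.prems by simp
  ultimately show ?case unfolding symmetric_pawbar.simps by presburger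
qed simp

section \<open>The directed algorithm on a cycle\<close>

locale directed_cycle =
  fixes n :: nat and V :: "'v set" and v :: "nat \<Rightarrow> 'v"
    and \<gamma>opt :: "('v \<times> 'v) list \<Rightarrow> 'a::euclidean_space measure \<Rightarrow> 'a measure \<Rightarrow> ('a \<times> 'a) measure"
    and a :: "'v \<times> 'v \<Rightarrow> real" and \<mu>0 :: "'v \<Rightarrow> 'a measure"
  assumes n: "2 \<le> n" and v: "bij_betw v {1..n} V"
    and sel: "optimal_plan_selection \<gamma>opt" and \<mu>0: "\<And>i. i \<in> V \<Longrightarrow> \<mu>0 i \<in> P2"
begin

definition nxt :: "nat \<Rightarrow> nat" where "nxt k = (if k = n then 1 else Suc k)"
definition prv :: "nat \<Rightarrow> nat" where "prv k = (if k = 1 then n else k - 1)"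
definition edge :: "nat \<Rightarrow> 'v \<times> 'v" where "edge k = (v k, v (nxt k))"
abbreviation "X \<equiv> directed_pawbar \<gamma>opt a \<mu>0"
definition D :: "(nat \<Rightarrow> 'v \<times> 'v) \<Rightarrow> nat \<Rightarrow> nat \<Rightarrow> real" where
  "D e t k = W2 (X e t (v k)) (X e t (v (nxt k)))"
definition S :: "(nat \<Rightarrow> 'v \<times> 'v) \<Rightarrow> nat \<Rightarrow> real" where
  "S e t = (\<Sum>k=1..n. D e t k)"

lemma nxt_in: "k \<in> {1..n} \<Longrightarrow> nxt k \<in> {1..n}"
  using n by (auto simp: nxt_def)

lemma v_in: "k \<in> {1..n} \<Longrightarrow> v k \<in> V"
  using v by (auto simp: bij_betw_def)

lemma v_eq_iff: "k \<in> {1..n} \<Longrightarrow> l \<in> {1..n} \<Longrightarrow> v k = v l \<longleftrightarrow> k = l"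
  using v by (auto simp: bij_betw_def inj_on_eq_iff)

lemma V_obtain: "i \<in> V \<Longrightarrow> \<exists>k\<in>{1..n}. i = v k"
  using v by (auto simp: bij_betw_def)

lemma D_nonneg: "0 \<le> D e t k" by (simp add: D_def)

lemma D_le_S: "k \<in> {1..n} \<Longrightarrow> D e t k \<le> S e t"
  unfolding S_def by (rule member_le_sum) (auto simp: D_nonneg)

text \<open>Agent \<open>n - 1\<close> is first pulled close to agent \<open>n\<close>, then \<open>n - 2\<close> close to \<open>n - 1\<close>, and so on:
  contracting the gap of edge \<open>k\<close> leaves the already small gaps of the later edges untouched.\<close>

definition sweep :: "nat \<Rightarrow> nat \<Rightarrow> ('v \<times> 'v) list" where
  "sweep m r = concat (map (\<lambda>i. replicate m (edge (n - 1 - i))) [0..<r])"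

context
  assumes a: "\<And>k. k \<in> {1..n} \<Longrightarrow> 0 < a (edge k) \<and> a (edge k) < 1"
begin

lemma step_at:
  assumes P: "\<And>i. i \<in> V \<Longrightarrow> X e t i \<in> P2" and k: "k \<in> {1..n}" "e t = edge k"
  obtains \<rho> where "X e (Suc t) = (X e t)(v k := \<rho>)" "\<rho> \<in> P2"
    "W2 (X e t (v k)) \<rho> \<le> a (edge k) * D e t k"
    "W2 \<rho> (X e t (v (nxt k))) \<le> (1 - a (edge k)) * D e t k"
proof -
  let ?\<gamma> = "\<gamma>opt (map e [0..<Suc t]) (X e t (v k)) (X e t (v (nxt k)))"
  have P2: "X e t (v k) \<in> P2" "X e t (v (nxt k)) \<in> P2" using P k v_in nxt_in by auto
  then have opt: "optimal_plan (X e t (v k)) (X e t (v (nxt k))) ?\<gamma>"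
    using sel unfolding optimal_plan_selection_def by blast
  have "0 \<le> a (edge k)" "a (edge k) \<le> 1" using a[OF k(1)] by auto
  note I = optimal_plan_interpolate[OF P2 opt this]
  have "X e (Suc t) = (X e t)(v k := distr ?\<gamma> borel (interpolate (a (edge k))))"
    using k(2) by (simp add: Let_def edge_def)
  then show ?thesis using that I unfolding D_def by blast
qed

lemma in_P2: "range e \<subseteq> edge ` {1..n} \<Longrightarrow> i \<in> V \<Longrightarrow> X e t i \<in> P2"
proof (induction t arbitrary: i)
  case (Suc t)
  obtain k where k: "k \<in> {1..n}" "e t = edge k" using Suc.prems(1) by blast
  obtain \<rho> where "X e (Suc t) = (X e t)(v k := \<rho>)" "\<rho> \<in> P2"
    by (rule step_at[OF Suc.IH[OF Suc.prems(1)] k])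
  then show ?case using Suc by (simp del: directed_pawbar.simps)
qed (simp add: \<mu>0)

context
  fixes e :: "nat \<Rightarrow> 'v \<times> 'v"
  assumes e: "range e \<subseteq> edge ` {1..n}"
begin

lemma D_step:
  assumes k: "k \<in> {1..n}" "e t = edge k"
  shows "D e (Suc t) k \<le> (1 - a (edge k)) * D e t k"
    and "D e (Suc t) (prv k) \<le> D e t (prv k) + a (edge k) * D e t k"
    and "l \<in> {1..n} \<Longrightarrow> l \<noteq> k \<Longrightarrow> l \<noteq> prv k \<Longrightarrow> D e (Suc t) l = D e t l"
    and "i \<in> V \<Longrightarrow> W2 (X e t i) (X e (Suc t) i) \<le> D e t k"
proof -
  note P = in_P2[OF e]
  obtain \<rho> where \<rho>: "X e (Suc t) = (X e t)(v k := \<rho>)" "\<rho> \<in> P2"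
    "W2 (X e t (v k)) \<rho> \<le> a (edge k) * D e t k"
    "W2 \<rho> (X e t (v (nxt k))) \<le> (1 - a (edge k)) * D e t k"
    by (rule step_at[OF P k])
  \<comment> \<open>From n \<ge> 2 agent \<open>k\<close> differs from both its neighbours. For n =
    2 the neighbours coincide, and the cases \<open>k\<close>, \<open>prv k\<close> and the rest are
    still disjoint.\<close>
  have ne: "nxt k \<noteq> k" "prv k \<noteq> k" "nxt (prv k) = k" and pk: "prv k \<in> {1..n}"
    using k n by (auto simp: nxt_def prv_def)
  have vne: "v (nxt k) \<noteq> v k" "v (prv k) \<noteq> v k"
    using v_eq_iff[OF nxt_in[OF k(1)] k(1)] v_eq_iff[OF pk k(1)] ne by auto
  show "D e (Suc t) k \<le> (1 - a (edge k)) * D e t k"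
    using \<rho>(4) vne by (simp add: D_def \<rho>(1) del: directed_pawbar.simps)
  show "D e (Suc t) (prv k) \<le> D e t (prv k) + a (edge k) * D e t k"
    using W2_triangle[OF P[OF v_in[OF pk], of t] P[OF v_in[OF k(1)], of t] \<rho>(2)] \<rho>(3) vne ne
    by (simp add: D_def \<rho>(1) del: directed_pawbar.simps)
  show "D e (Suc t) l = D e t l" if l: "l \<in> {1..n}" "l \<noteq> k" "l \<noteq> prv k"
  proof -
    have "nxt l \<noteq> k" using l k n by (auto simp: nxt_def prv_def split: if_splits)
    then have "v l \<noteq> v k" "v (nxt l) \<noteq> v k"
      using v_eq_iff[OF l(1) k(1)] v_eq_iff[OF nxt_in[OF l(1)] k(1)] l by auto
    then show ?thesis by (simp add: D_def \<rho>(1) del: directed_pawbar.simps)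
  qed
  show "W2 (X e t i) (X e (Suc t) i) \<le> D e t k" if i: "i \<in> V"
  proof (cases "i = v k")
    case True
    have "a (edge k) * D e t k \<le> 1 * D e t k"
      using a[OF k(1)] by (intro mult_right_mono D_nonneg) auto
    then show ?thesis using True \<rho>(3) by (simp add: \<rho>(1) del: directed_pawbar.simps)
  next
    case False
    then show ?thesis using W2_refl[OF P[OF i]] D_nonneg by (simp add: \<rho>(1) del: directed_pawbar.simps)
  qed
qed

lemma edge_at: "\<exists>k\<in>{1..n}. e t = edge k"
  using e by blast

lemma S_decr: "S e (Suc t) \<le> S e t"
proof -
  obtain k where k: "k \<in> {1..n}" "e t = edge k" using edge_at by blast
  let ?d = "a (edge k) * D e t k"
  have pk: "prv k \<in> {1..n}" "prv k \<noteq> k" using k n by (auto simp: prv_def)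
  \<comment> \<open>What gap \<open>k\<close> surely loses equals what gap \<open>prv k\<close>
    gains at most, so the two corrections cancel in the sum.\<close>
  have "S e (Suc t) \<le> (\<Sum>l=1..n. D e t l + (if l = prv k then ?d else 0) - (if l = k then ?d else 0))"
    unfolding S_def
  proof (rule sum_mono)
    fix l assume "l \<in> {1..n}"
    then show "D e (Suc t) l \<le> D e t l + (if l = prv k then ?d else 0) - (if l = k then ?d else 0)"
      using D_step(1,2)[OF k] D_step(3)[OF k, of l] pk
      by (cases "l = k"; cases "l = prv k") (auto simp: algebra_simps)
  qed
  also have "\<dots> = S e t"
    using k pk by (simp add: S_def sum.distrib sum_subtractf)
  finally show ?thesis .
qed

lemma S_antimono: "t \<le> t' \<Longrightarrow> S e t' \<le> S e t"
  by (induction rule: dec_induct) (auto intro: order_trans[OF S_decr])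

lemma closing_edge: "D e t n \<le> (\<Sum>k=1..<n. D e t k)"
  and W2_diam: "i \<in> V \<Longrightarrow> j \<in> V \<Longrightarrow> W2 (X e t i) (X e t j) \<le> (\<Sum>k=1..<n. D e t k)"
proof -
  have *: "W2 (X e t (v k)) (X e t (v l)) \<le> (\<Sum>k=1..<n. D e t k)" if "k \<in> {1..n}" "l \<in> {1..n}" for k l
    using W2_chain_diam[OF that, of "\<lambda>k. X e t (v k)"] in_P2[OF e v_in]
    by (simp add: D_def nxt_def)
  show "D e t n \<le> (\<Sum>k=1..<n. D e t k)"
    using *[of n 1] n by (simp add: D_def nxt_def)
  show "W2 (X e t i) (X e t j) \<le> (\<Sum>k=1..<n. D e t k)" if "i \<in> V" "j \<in> V"
    using V_obtain that * by metis
qed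

text \<open>Selecting edge \<open>k\<close> can raise only the gap of \<open>prv k\<close>, which is
  k - 1, or n when k = 1. Neither lies strictly between \<open>k\<close> and \<open>n\<close>, which
  is why the sweep runs through the labels downwards.\<close>

lemma D_replicate:
  assumes k: "k \<in> {1..<n}" and q: "\<And>l. l \<in> {1..n} \<Longrightarrow> 1 - a (edge l) \<le> q" and q0: "0 \<le> q"
  shows "occurs e t (replicate m (edge k)) \<Longrightarrow>
    D e (t + m) k \<le> q ^ m * D e t k \<and> (\<forall>l. k < l \<and> l < n \<longrightarrow> D e (t + m) l = D e t l)"
proof (induction m)
  case (Suc m)
  have k': "k \<in> {1..n}" using k by auto
  have "occurs e t (replicate m (edge k) @ [edge k])"
    using Suc.prems by (simp add: replicate_append_same)
  then have occ: "occurs e t (replicate m (edge k))" and ek: "e (t + m) = edge k"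
    by (auto simp: occurs_append occurs_Cons)
  note IH = Suc.IH[OF occ]
  have "D e (Suc (t + m)) k \<le> (1 - a (edge k)) * D e (t + m) k"
    by (rule D_step(1)[where k=k, OF k' ek])
  also have "\<dots> \<le> q * (q ^ m * D e t k)"
    using q[OF k'] IH q0 D_nonneg by (intro mult_mono) auto
  finally have "D e (t + Suc m) k \<le> q ^ Suc m * D e t k" by (simp add: mult.assoc)
  moreover have "D e (t + Suc m) l = D e t l" if l: "k < l" "l < n" for l
  proof -
    have "l \<in> {1..n}" "l \<noteq> k" "l \<noteq> prv k" using l k by (auto simp: prv_def split: if_splits)
    from D_step(3)[OF k' ek this] show ?thesis using IH l by simp
  qed
  ultimately show ?case by blast
qed simp

lemma D_sweep:
  assumes q: "\<And>l. l \<in> {1..n} \<Longrightarrow> 1 - a (edge l) \<le> q" and q0: "0 \<le> q"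
  shows "r \<le> n - 1 \<Longrightarrow> occurs e t (sweep m r) \<Longrightarrow>
    (\<forall>k. n - r \<le> k \<and> k < n \<longrightarrow> D e (t + length (sweep m r)) k \<le> q ^ m * S e t)"
proof (induction r)
  case (Suc r)
  let ?k = "n - 1 - r" and ?t = "t + length (sweep m r)"
  have sw: "sweep m (Suc r) = sweep m r @ replicate m (edge ?k)" by (simp add: sweep_def)
  then have occ: "occurs e t (sweep m r)" "occurs e ?t (replicate m (edge ?k))"
    using Suc.prems(2) by (auto simp: occurs_append)
  have k: "?k \<in> {1..<n}" using Suc.prems(1) n by auto
  note R = D_replicate[OF k q q0 occ(2)]
  have IH: "\<forall>k. n - r \<le> k \<and> k < n \<longrightarrow> D e ?t k \<le> q ^ m * S e t"
    using Suc.IH occ(1) Suc.prems(1) by simp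
  have "D e (?t + m) ?k \<le> q ^ m * D e ?t ?k" using R by blast
  \<comment> \<open>Earlier selections may have enlarged the gap about to be contracted, but never
    beyond the sum of all gaps at the start of the sweep.\<close>
  also have "\<dots> \<le> q ^ m * S e t"
    using D_le_S[of ?k e ?t] S_antimono[of t ?t] k q0 by (intro mult_left_mono) auto
  finally have new: "D e (?t + m) ?k \<le> q ^ m * S e t" .
  have len: "t + length (sweep m (Suc r)) = ?t + m" by (simp add: sw)
  show ?case
  proof (intro allI impI)
    fix k assume k: "n - Suc r \<le> k \<and> k < n"
    show "D e (t + length (sweep m (Suc r))) k \<le> q ^ m * S e t"
    proof (cases "k = ?k")
      case True
      then show ?thesis unfolding len using new by blast
    next
      case False
      then have "?k < k" "n - r \<le> k" using k by auto
      then show ?thesis unfolding len using R IH k by metis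
    qed
  qed
qed simp

text \<open>The n - 1 swept gaps are at most \<open>S e t\<close> / (4 n) each, so they add up to at
  most a quarter of \<open>S e t\<close>; the closing edge at most doubles this.\<close>

lemma S_sweep:
  assumes q: "\<And>l. l \<in> {1..n} \<Longrightarrow> 1 - a (edge l) \<le> q" and q0: "0 \<le> q"
    and occ: "occurs e t (sweep m (n - 1))" and m: "q ^ m \<le> 1 / (4 * real n)"
  shows "S e (t + length (sweep m (n - 1))) \<le> 1/2 * S e t"
proof -
  let ?t = "t + length (sweep m (n - 1))"
  have small: "D e ?t k \<le> q ^ m * S e t" if "k \<in> {1..<n}" for k
    using D_sweep[OF q q0 _ occ] that by auto
  have S0: "0 \<le> S e t" unfolding S_def by (intro sum_nonneg D_nonneg)
  have "S e ?t = D e ?t n + (\<Sum>k=1..<n. D e ?t k)"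
    using n unfolding S_def by (subst sum.last_plus) auto
  also have "\<dots> \<le> 2 * (\<Sum>k=1..<n. D e ?t k)" using closing_edge[of ?t] by simp
  also have "(\<Sum>k=1..<n. D e ?t k) \<le> (\<Sum>k=1..<n. q ^ m * S e t)"
    by (intro sum_mono small)
  also have "(\<Sum>k=1..<n. q ^ m * S e t) = real (n - 1) * (q ^ m * S e t)" by simp
  also have "\<dots> \<le> real n * (1 / (4 * real n) * S e t)"
    using m S0 q0 by (intro mult_mono) auto
  also have "\<dots> = 1/4 * S e t" using n by simp
  finally show ?thesis by simp
qed

end

lemma reaches_consensus:
  assumes p: "set_pmf p = edge ` {1..n}"
  shows "reaches_random_consensus V (edge_selection_law p) \<mu>0 X"
proof -
  \<comment> \<open>The worst of the finitely many factors 1 - a, still below 1.\<close>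
  define q where "q = Max ((\<lambda>l. 1 - a (edge l)) ` {1..n})"
  have q: "1 - a (edge l) \<le> q" if "l \<in> {1..n}" for l
    unfolding q_def using that by (intro Max_ge) auto
  have q1: "q < 1" unfolding q_def using n a by (subst Max_less_iff) auto
  have q0: "0 \<le> q" using q[of 1] a[of 1] n by auto
  obtain m where m: "q ^ m < 1 / (4 * real n)"
    using real_arch_pow_inv[of "1 / (4 * real n)" q] q1 n by auto
  \<comment> \<open>Guarantees a nonempty sweep, so that the blocks of the edge sequence have
    positive length.\<close>
  have "m \<noteq> 0"
  proof
    assume "m = 0"
    then have "4 * real n < 1" using m n by (simp add: field_simps)
    then show False using n by simp
  qed
  show ?thesis
  proof (rule reaches_random_consensus_if_contracting[where S=S and w="sweep m (n - 1)" and c="1/2"])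
    show "V \<noteq> {}" using v_in[of 1] n by auto
    show "finite (set_pmf p)" by (simp add: p)
    show "X e 0 = \<mu>0" for e by simp
    show "X e t = X e' t" if "\<And>s. s < t \<Longrightarrow> e s = e' s" for e e' t
      by (rule directed_pawbar_adapted[OF that])
    fix e :: "nat \<Rightarrow> 'v \<times> 'v" assume "range e \<subseteq> set_pmf p"
    then have e: "range e \<subseteq> edge ` {1..n}" by (simp add: p)
    show "X e t i \<in> P2" if "i \<in> V" for t i by (rule in_P2[OF e that])
    show "W2 (X e t i) (X e t j) \<le> S e t" if "i \<in> V" "j \<in> V" for t i j
    proof -
      have "(\<Sum>k=1..<n. D e t k) \<le> S e t"
        unfolding S_def by (intro sum_mono2) (auto simp: D_nonneg)
      then show ?thesis using W2_diam[OF e that, of t] by simp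
    qed
    show "W2 (X e t i) (X e (Suc t) i) \<le> S e t" if "i \<in> V" for t i
    proof -
      obtain k where k: "k \<in> {1..n}" "e t = edge k" using edge_at[OF e] by blast
      show ?thesis using D_step(4)[OF e k that] D_le_S[OF k(1), of e t] by simp
    qed
    show "S e (Suc t) \<le> S e t" for t by (rule S_decr[OF e])
    show "S e (t + length (sweep m (n - 1))) \<le> 1/2 * S e t" if "occurs e t (sweep m (n - 1))" for t
      using m by (intro S_sweep[OF e q q0 that]) auto
    show "S e 0 \<le> 0" if "\<forall>i\<in>V. \<forall>j\<in>V. \<mu>0 i = \<mu>0 j"
    proof -
      have "D e 0 k = 0" if "k \<in> {1..n}" for k
      proof -
        have "\<mu>0 (v k) = \<mu>0 (v (nxt k))" "\<mu>0 (v k) \<in> P2"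
          using \<open>\<forall>i\<in>V. \<forall>j\<in>V. \<mu>0 i = \<mu>0 j\<close> v_in[OF that] v_in[OF nxt_in[OF that]] \<mu>0 by blast+
        then show ?thesis using W2_refl by (simp add: D_def)
      qed
      then show ?thesis by (simp add: S_def)
    qed
  next
    show "set (sweep m (n - 1)) \<subseteq> set_pmf p" by (auto simp: sweep_def p)
    show "sweep m (n - 1) \<noteq> []" using \<open>m \<noteq> 0\<close> n by (auto simp: sweep_def intro!: exI[of _ 0])
  qed auto
qed

end

end

section \<open>The symmetric algorithm on a line\<close>

locale symmetric_line =
  fixes n :: nat and V :: "'v::linorder set" and v :: "nat \<Rightarrow> 'v"
    and \<gamma>opt :: "'v set list \<Rightarrow> 'a::euclidean_space measure \<Rightarrow> 'a measure \<Rightarrow> ('a \<times> 'a) measure"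
    and \<mu>0 :: "'v \<Rightarrow> 'a measure"
  assumes n: "2 \<le> n" and v: "bij_betw v {1..n} V"
    and sel: "optimal_plan_selection \<gamma>opt" and \<mu>0: "\<And>i. i \<in> V \<Longrightarrow> \<mu>0 i \<in> P2"
begin

definition edge :: "nat \<Rightarrow> 'v set" where "edge k = {v k, v (Suc k)}"
abbreviation "X \<equiv> symmetric_pawbar \<gamma>opt \<mu>0"
definition D :: "(nat \<Rightarrow> 'v set) \<Rightarrow> nat \<Rightarrow> nat \<Rightarrow> real" where
  "D e t k = W2 (X e t (v k)) (X e t (v (Suc k)))"

text \<open>The concave weights \<open>k * (n - k)\<close> have second difference \<open>-2\<close> and vanish at \<open>0\<close> and \<open>n\<close>.
  Selecting edge \<open>k\<close> moves half of its gap to each neighbouring edge, so the weighted sum drops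
  by the full gap.\<close>

definition weight :: "nat \<Rightarrow> real" where "weight k = real k * (real n - real k)"
definition S :: "(nat \<Rightarrow> 'v set) \<Rightarrow> nat \<Rightarrow> real" where
  "S e t = (\<Sum>k=1..<n. weight k * D e t k)"

lemma v_in: "k \<in> {1..n} \<Longrightarrow> v k \<in> V"
  using v by (auto simp: bij_betw_def)

lemma v_eq_iff: "k \<in> {1..n} \<Longrightarrow> l \<in> {1..n} \<Longrightarrow> v k = v l \<longleftrightarrow> k = l"
  using v by (auto simp: bij_betw_def inj_on_eq_iff)

lemma V_obtain: "i \<in> V \<Longrightarrow> \<exists>k\<in>{1..n}. i = v k"
  using v by (auto simp: bij_betw_def)

lemma D_nonneg: "0 \<le> D e t k" by (simp add: D_def)

lemma weight_ge_1: "k \<in> {1..<n} \<Longrightarrow> 1 \<le> weight k"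
  using mult_mono[of 1 "real k" 1 "real n - real k"] by (auto simp: weight_def)

lemma sum_D_le_S: "(\<Sum>k=1..<n. D e t k) \<le> S e t"
  unfolding S_def
proof (rule sum_mono)
  fix k assume "k \<in> {1..<n}"
  then show "D e t k \<le> weight k * D e t k"
    using mult_right_mono[OF weight_ge_1 D_nonneg, of k e t k] by simp
qed

lemma step_at:
  assumes P: "\<And>i. i \<in> V \<Longrightarrow> X e t i \<in> P2" and k: "k \<in> {1..<n}" "e t = edge k"
  obtains \<rho> where "X e (Suc t) = (X e t)(v k := \<rho>, v (Suc k) := \<rho>)" "\<rho> \<in> P2"
    "W2 (X e t (v k)) \<rho> \<le> D e t k / 2" "W2 \<rho> (X e t (v (Suc k))) \<le> D e t k / 2"
proof -
  define i j where "i = Min (e t)" and "j = Max (e t)"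
  let ?\<gamma> = "\<gamma>opt (map e [0..<Suc t]) (X e t i) (X e t j)"
  let ?\<rho> = "distr ?\<gamma> borel (interpolate (1/2))"
  have "v k \<noteq> v (Suc k)" using v_eq_iff[of k "Suc k"] k by auto
  \<comment> \<open>The order of the agents' names may run against the labelling of the line; the
    second case reduces to the first by symmetry of \<open>W2\<close> and of the midpoint.\<close>
  then consider "i = v k" "j = v (Suc k)" | "i = v (Suc k)" "j = v k"
    using k(2) by (cases "v k < v (Suc k)") (auto simp: i_def j_def edge_def min_def max_def)
  note ij = this
  have V: "X e t (v k) \<in> P2" "X e t (v (Suc k)) \<in> P2" using P v_in k by auto
  have P2: "X e t i \<in> P2" "X e t j \<in> P2" using ij V by (cases; simp)+
  then have opt: "optimal_plan (X e t i) (X e t j) ?\<gamma>"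
    using sel unfolding optimal_plan_selection_def by blast
  have "(0::real) \<le> 1/2" "1/2 \<le> (1::real)" by auto
  note I = optimal_plan_interpolate[OF P2 opt this]
  have sym: "W2 (X e t i) (X e t j) = W2 (X e t j) (X e t i)" "W2 (X e t i) ?\<rho> = W2 ?\<rho> (X e t i)"
    "W2 (X e t j) ?\<rho> = W2 ?\<rho> (X e t j)"
    by (intro W2_commute P2 I(1))+
  have upd: "X e (Suc t) = (X e t)(i := ?\<rho>, j := ?\<rho>)"
    by (simp add: Let_def i_def j_def)
  from ij show ?thesis
  proof cases
    case 1
    show ?thesis
      by (rule that[of ?\<rho>]) (use upd I 1 in \<open>auto simp: D_def\<close>)
  next
    case 2
    show ?thesis
      by (rule that[of ?\<rho>])
        (use upd I 2 sym \<open>v k \<noteq> v (Suc k)\<close> in \<open>auto simp: D_def fun_upd_twist\<close>)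
  qed
qed

lemma in_P2: "range e \<subseteq> edge ` {1..<n} \<Longrightarrow> i \<in> V \<Longrightarrow> X e t i \<in> P2"
proof (induction t arbitrary: i)
  case (Suc t)
  obtain k where k: "k \<in> {1..<n}" "e t = edge k" using Suc.prems(1) by blast
  obtain \<rho> where "X e (Suc t) = (X e t)(v k := \<rho>, v (Suc k) := \<rho>)" "\<rho> \<in> P2"
    by (rule step_at[OF Suc.IH[OF Suc.prems(1)] k])
  then show ?case using Suc by (simp del: symmetric_pawbar.simps)
qed (simp add: \<mu>0)

context
  fixes e :: "nat \<Rightarrow> 'v set"
  assumes e: "range e \<subseteq> edge ` {1..<n}"
begin

lemma edge_at: "\<exists>k\<in>{1..<n}. e t = edge k"
  using e by blast

text \<open>Each endpoint of edge \<open>k\<close> moves by at most half of its gap, and a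
  neighbouring edge shares exactly one of them. The upper estimate drives the decrease of
  \<open>S\<close>; the lower one prevents a large gap from vanishing before it is selected unless
  other large gaps were selected first.\<close>

lemma D_step:
  assumes k: "k \<in> {1..<n}" "e t = edge k"
  shows "l \<in> {1..<n} \<Longrightarrow> D e (Suc t) l \<le>
      D e t l + D e t k * (if l = k then - 1 else if l = Suc k \<or> Suc l = k then 1/2 else 0)"
    and "l \<in> {1..<n} \<Longrightarrow> D e t l \<le> D e (Suc t) l + D e t k"
    and "i \<in> V \<Longrightarrow> W2 (X e t i) (X e (Suc t) i) \<le> D e t k"
proof -
  note P = in_P2[OF e]
  obtain \<rho> where \<rho>: "X e (Suc t) = (X e t)(v k := \<rho>, v (Suc k) := \<rho>)" "\<rho> \<in> P2"
    "W2 (X e t (v k)) \<rho> \<le> D e t k / 2" "W2 \<rho> (X e t (v (Suc k))) \<le> D e t k / 2"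
    by (rule step_at[OF P k])
  have kk: "k \<in> {1..n}" "Suc k \<in> {1..n}" using k by auto
  have Vk: "X e t (v k) \<in> P2" "X e t (v (Suc k)) \<in> P2" using P v_in kk by auto
  have Y: "X e (Suc t) (v m) = (if m = k \<or> m = Suc k then \<rho> else X e t (v m))" if "m \<in> {1..n}" for m
    using v_eq_iff[OF that kk(1)] v_eq_iff[OF that kk(2)] by (auto simp: \<rho>(1) simp del: symmetric_pawbar.simps)
  have "(D e (Suc t) l \<le>
      D e t l + D e t k * (if l = k then - 1 else if l = Suc k \<or> Suc l = k then 1/2 else 0)) \<and>
      D e t l \<le> D e (Suc t) l + D e t k" if l: "l \<in> {1..<n}" for l
  proof -
    have ll: "l \<in> {1..n}" "Suc l \<in> {1..n}" using l by auto
    consider "l = k" | "l = Suc k" | "Suc l = k" | "l \<noteq> k" "l \<noteq> Suc k" "Suc l \<noteq> k" by blast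
    then show ?thesis
    proof cases
      case 1
      then show ?thesis using W2_refl[OF \<rho>(2)] kk D_nonneg[of e t k]
        by (simp add: D_def Y del: symmetric_pawbar.simps)
    next
      case 2
      let ?Z = "X e t (v (Suc l))"
      have Z: "?Z \<in> P2" using P v_in ll by blast
      have "W2 \<rho> ?Z \<le> W2 \<rho> (X e t (v l)) + W2 (X e t (v l)) ?Z"
        "W2 (X e t (v l)) ?Z \<le> W2 (X e t (v l)) \<rho> + W2 \<rho> ?Z"
        "W2 (X e t (v l)) \<rho> = W2 \<rho> (X e t (v l))"
        using Vk \<rho>(2) Z 2 by (auto intro: W2_triangle W2_commute)
      then show ?thesis using 2 ll \<rho>(4) D_nonneg[of e t k]
        by (auto simp: D_def Y simp del: symmetric_pawbar.simps)
    next
      case 3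
      let ?Z = "X e t (v l)"
      have Z: "?Z \<in> P2" using P v_in ll by blast
      have "W2 ?Z \<rho> \<le> W2 ?Z (X e t (v k)) + W2 (X e t (v k)) \<rho>"
        "W2 ?Z (X e t (v k)) \<le> W2 ?Z \<rho> + W2 \<rho> (X e t (v k))"
        "W2 (X e t (v k)) \<rho> = W2 \<rho> (X e t (v k))"
        using Vk \<rho>(2) Z by (auto intro: W2_triangle W2_commute)
      then show ?thesis using 3 ll \<rho>(3) D_nonneg[of e t k]
        by (auto simp: D_def Y simp del: symmetric_pawbar.simps)
    next
      case 4
      then have "D e (Suc t) l = D e t l" using ll by (simp add: D_def Y del: symmetric_pawbar.simps)
      then show ?thesis using 4 D_nonneg[of e t k] by simp
    qed
  qed
  then show "l \<in> {1..<n} \<Longrightarrow> D e (Suc t) l \<le>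
      D e t l + D e t k * (if l = k then - 1 else if l = Suc k \<or> Suc l = k then 1/2 else 0)"
    and "l \<in> {1..<n} \<Longrightarrow> D e t l \<le> D e (Suc t) l + D e t k" by blast+
  show "W2 (X e t i) (X e (Suc t) i) \<le> D e t k" if i: "i \<in> V"
  proof -
    obtain m where m: "m \<in> {1..n}" "i = v m" using V_obtain[OF i] by blast
    have "W2 (X e t (v (Suc k))) \<rho> = W2 \<rho> (X e t (v (Suc k)))"
      by (intro W2_commute Vk \<rho>(2))
    then show ?thesis
      using \<rho>(3,4) D_nonneg[of e t k] W2_refl[OF P[OF i], of t]
      by (auto simp: m Y[OF m(1)] simp del: symmetric_pawbar.simps)
  qed
qed

lemma S_step:
  assumes k: "k \<in> {1..<n}" "e t = edge k"
  shows "S e (Suc t) \<le> S e t - D e t k"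
proof -
  let ?c = "\<lambda>l. if l = k then - 1 else if l = Suc k \<or> Suc l = k then 1/2 else 0 :: real"
  have "S e (Suc t) \<le> (\<Sum>l=1..<n. weight l * (D e t l + D e t k * ?c l))"
    unfolding S_def using weight_ge_1 by (intro sum_mono mult_left_mono D_step k) (auto intro: order_trans[of 0 1])
  also have "\<dots> = S e t + D e t k * (\<Sum>l=1..<n. weight l * ?c l)"
    by (simp add: S_def sum.distrib sum_distrib_left algebra_simps)
  also have "(\<Sum>l=1..<n. weight l * ?c l) = - 1"
  proof -
    have "(\<Sum>l=1..<n. weight l * ?c l) = (\<Sum>l=1..<n.
        (if l = k then - weight k else 0) + (if l = Suc k then weight (Suc k) / 2 else 0) +
        (if l = k - 1 then weight (k - 1) / 2 else 0))"
      using k by (intro sum.cong) auto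
    also have "\<dots> = - weight k + (if Suc k \<in> {1..<n} then weight (Suc k) / 2 else 0) +
        (if k - 1 \<in> {1..<n} then weight (k - 1) / 2 else 0)"
      using k by (simp add: sum.distrib)
    \<comment> \<open>At an end of the line a neighbouring edge is missing; its weight is 0, so the
      second difference can be taken as if it were present.\<close>
    also have "(if Suc k \<in> {1..<n} then weight (Suc k) / 2 else 0) = weight (Suc k) / 2"
    proof (cases "Suc k \<in> {1..<n}")
      case False
      then have "Suc k = n" using k by auto
      then have "real n = real k + 1" by simp
      then show ?thesis using False by (simp add: weight_def)
    qed simp
    also have "(if k - 1 \<in> {1..<n} then weight (k - 1) / 2 else 0) = weight (k - 1) / 2"
      using k by (cases "k = 1") (auto simp: weight_def)
    also have "- weight k + weight (Suc k) / 2 + weight (k - 1) / 2 = - 1"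
      using k by (simp add: weight_def of_nat_diff field_simps)
    finally show ?thesis .
  qed
  finally show ?thesis by simp
qed

lemma S_decr: "S e (Suc t) \<le> S e t"
  using edge_at[of t] S_step[of _ t] D_nonneg[of e t] by (meson diff_left_mono diff_zero order_trans order_refl diff_le_eq le_add_same_cancel1)

lemma W2_diam: "i \<in> V \<Longrightarrow> j \<in> V \<Longrightarrow> W2 (X e t i) (X e t j) \<le> (\<Sum>k=1..<n. D e t k)"
proof -
  assume "i \<in> V" "j \<in> V"
  then obtain k l where "k \<in> {1..n}" "l \<in> {1..n}" "i = v k" "j = v l" using V_obtain by metis
  then show ?thesis
    using W2_chain_diam[of k n l "\<lambda>k. X e t (v k)"] in_P2[OF e v_in] by (simp add: D_def)
qed

text \<open>Before edge \<open>l\<close> is selected its gap changes by at most the gaps selected so far, so after a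
  full pass every initial gap is bounded by the total decrease of \<open>S\<close>.\<close>

lemma S_pass:
  assumes "occurs e t (map edge [1..<n])"
  shows "S e (t + (n - 1)) \<le> (sum weight {1..<n} / (sum weight {1..<n} + 1)) * S e t"
proof -
  have sel: "e (t + j) = edge (Suc j)" if "j < n - 1" for j
    using assms that by (auto simp: occurs_def)
  let ?g = "\<lambda>j. D e (t + j) (Suc j)"
  have tot: "S e (t + r) \<le> S e t - (\<Sum>j<r. ?g j)" if "r \<le> n - 1" for r
    using that
  proof (induction r)
    case (Suc r)
    have "S e (Suc (t + r)) \<le> S e (t + r) - ?g r"
      using Suc.prems by (intro S_step sel) auto
    then show ?case using Suc by simp
  qed simp
  have gap: "D e t l \<le> D e (t + r) l + (\<Sum>j<r. ?g j)" if "r \<le> n - 1" "l \<in> {1..<n}" for r l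
    using that
  proof (induction r)
    case (Suc r)
    have "D e (t + r) l \<le> D e (Suc (t + r)) l + ?g r"
      using Suc.prems by (intro D_step(2) sel) auto
    then show ?case using Suc by simp
  qed simp
  let ?\<Delta> = "S e t - S e (t + (n - 1))" and ?W = "sum weight {1..<n}"
  have D: "D e t l \<le> ?\<Delta>" if l: "l \<in> {1..<n}" for l
  proof -
    have "D e t l \<le> D e (t + (l - 1)) l + (\<Sum>j<l - 1. ?g j)"
      using l by (intro gap) auto
    \<comment> \<open>At time t + (l - 1) edge \<open>l\<close> itself is selected, so its current
      gap is the next term of the sum.\<close>
    also have "\<dots> = (\<Sum>j<Suc (l - 1). ?g j)" using l by (cases l) auto
    also have "\<dots> \<le> (\<Sum>j<n - 1. ?g j)"
      using l by (intro sum_mono2) (auto simp: D_nonneg)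
    also have "\<dots> \<le> ?\<Delta>" using tot[of "n - 1"] by simp
    finally show ?thesis .
  qed
  have W: "0 \<le> ?W" using weight_ge_1 by (intro sum_nonneg) (auto intro: order_trans[of 0 1])
  have \<Delta>: "0 \<le> ?\<Delta>" using tot[of "n - 1"] D_nonneg by (smt (verit) order_refl sum_nonneg)
  have "S e t = (\<Sum>l=1..<n. weight l * D e t l)" by (simp add: S_def)
  also have "\<dots> \<le> (\<Sum>l=1..<n. weight l * ?\<Delta>)"
    using D weight_ge_1
    by (intro sum_mono mult_left_mono) (auto intro: order_trans[of 0 1])
  also have "\<dots> = ?W * ?\<Delta>" by (simp add: sum_distrib_right)
  \<comment> \<open>This would give the factor 1 - 1/W, which is 0 for n = 2 since then W = 1.
    Adding \<open>0 \<le> ?\<Delta>\<close> weakens it to W / (W + 1), which lies strictly between 0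
    and 1 for every n \<ge> 2.\<close>
  finally have "S e t \<le> ?W * ?\<Delta>" .
  then have "S e (t + (n - 1)) * (?W + 1) \<le> ?W * S e t"
    using \<Delta> by (simp add: algebra_simps)
  then show ?thesis using W by (simp add: pos_le_divide_eq)
qed

end

lemma reaches_consensus:
  assumes p: "set_pmf p = edge ` {1..<n}"
  shows "reaches_random_consensus V (edge_selection_law p) \<mu>0 X"
proof -
  let ?W = "sum weight {1..<n}"
  have W: "0 < ?W"
    using weight_ge_1 n by (intro sum_pos) (auto intro: less_le_trans[of 0 1])
  show ?thesis
  proof (rule reaches_random_consensus_if_contracting[where S=S and w="map edge [1..<n]" and c="?W / (?W + 1)"])
    show "V \<noteq> {}" using v_in[of 1] n by auto
    show "finite (set_pmf p)" by (simp add: p)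
    show "X e 0 = \<mu>0" for e by simp
    show "X e t = X e' t" if "\<And>s. s < t \<Longrightarrow> e s = e' s" for e e' t
      by (rule symmetric_pawbar_adapted[OF that])
    fix e :: "nat \<Rightarrow> 'v set" assume "range e \<subseteq> set_pmf p"
    then have e: "range e \<subseteq> edge ` {1..<n}" by (simp add: p)
    show "X e t i \<in> P2" if "i \<in> V" for t i by (rule in_P2[OF e that])
    show "W2 (X e t i) (X e t j) \<le> S e t" if "i \<in> V" "j \<in> V" for t i j
      using W2_diam[OF e that, of t] sum_D_le_S[of e t] by simp
    show "W2 (X e t i) (X e (Suc t) i) \<le> S e t" if "i \<in> V" for t i
    proof -
      obtain k where k: "k \<in> {1..<n}" "e t = edge k" using edge_at[OF e] by blast
      have "D e t k \<le> (\<Sum>k=1..<n. D e t k)" using k by (intro member_le_sum) (auto simp: D_nonneg)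
      then show ?thesis using D_step(3)[OF e k that] sum_D_le_S[of e t] by simp
    qed
    show "S e (Suc t) \<le> S e t" for t by (rule S_decr[OF e])
    show "S e (t + length (map edge [1..<n])) \<le> ?W / (?W + 1) * S e t"
      if "occurs e t (map edge [1..<n])" for t
      using S_pass[OF e that] by simp
    show "S e 0 \<le> 0" if "\<forall>i\<in>V. \<forall>j\<in>V. \<mu>0 i = \<mu>0 j"
    proof -
      have "D e 0 k = 0" if "k \<in> {1..<n}" for k
      proof -
        have "v k \<in> V" "v (Suc k) \<in> V" using v_in that by auto
        then have "\<mu>0 (v k) = \<mu>0 (v (Suc k))" "\<mu>0 (v k) \<in> P2"
          using \<open>\<forall>i\<in>V. \<forall>j\<in>V. \<mu>0 i = \<mu>0 j\<close> \<mu>0 by blast+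
        then show ?thesis using W2_refl by (simp add: D_def)
      qed
      then show ?thesis by (simp add: S_def)
    qed
  next
    show "set (map edge [1..<n]) \<subseteq> set_pmf p" by (auto simp: p)
    show "map edge [1..<n] \<noteq> []" using n by auto
    show "0 < ?W / (?W + 1)" "?W / (?W + 1) < 1" using W by auto
  qed
qed

end

theorem theorem3p10:
  fixes n :: nat and V :: "nat set" and \<mu>0 :: "nat \<Rightarrow> (real ^ 'd) measure"
  assumes "n \<ge> 2" and "V = {1..n}" and "\<forall>i\<in>V. \<mu>0 i \<in> P2"
  shows
    "(\<forall>E a p \<gamma>opt. cycle_graph V E \<longrightarrow> (\<forall>e\<in>E. 0 < a e \<and> a e < 1) \<longrightarrow> set_pmf p = E \<longrightarrow>
        optimal_plan_selection \<gamma>opt \<longrightarrow>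
        reaches_random_consensus V (edge_selection_law p) \<mu>0 (directed_pawbar \<gamma>opt a \<mu>0)) \<and>
     (\<forall>E p \<gamma>opt. line_graph V E \<longrightarrow> set_pmf p = E \<longrightarrow> optimal_plan_selection \<gamma>opt \<longrightarrow>
        reaches_random_consensus V (edge_selection_law p) \<mu>0 (symmetric_pawbar \<gamma>opt \<mu>0))"
proof (intro conjI allI impI)
  have card: "card V = n" using assms(2) by simp
  fix E and a :: "nat \<times> nat \<Rightarrow> real" and p and \<gamma>opt :: "(nat \<times> nat) list \<Rightarrow> (real ^ 'd) measure \<Rightarrow> (real ^ 'd) measure \<Rightarrow> ((real ^ 'd) \<times> (real ^ 'd)) measure"
  assume G: "cycle_graph V E" and a: "\<forall>e\<in>E. 0 < a e \<and> a e < 1" and p: "set_pmf p = E"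
    and sel: "optimal_plan_selection \<gamma>opt"
  obtain v where v: "bij_betw v {1..n} V"
    and E: "E = {(v k, v (k + 1)) | k. 1 \<le> k \<and> k < n} \<union> {(v n, v 1)}"
    using G unfolding cycle_graph_def card by blast
  interpret directed_cycle n V v \<gamma>opt a \<mu>0
    using assms v sel by unfold_locales auto
  have E': "E = edge ` {1..n}"
  proof
    show "E \<subseteq> edge ` {1..n}"
    proof
      fix x assume "x \<in> E"
      then consider k where "1 \<le> k" "k < n" "x = (v k, v (k + 1))" | "x = (v n, v 1)" using E by blast
      then show "x \<in> edge ` {1..n}"
      proof cases
        case 1
        then show ?thesis by (intro image_eqI[of _ _ k]) (auto simp: edge_def nxt_def)
      next
        case 2
        then show ?thesis using assms(1) by (intro image_eqI[of _ _ n]) (auto simp: edge_def nxt_def)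
      qed
    qed
    show "edge ` {1..n} \<subseteq> E"
    proof
      fix x assume "x \<in> edge ` {1..n}"
      then obtain k where k: "1 \<le> k" "k \<le> n" "x = edge k" by auto
      then show "x \<in> E"
        unfolding E by (cases "k = n") (auto simp: edge_def nxt_def)
    qed
  qed
  show "reaches_random_consensus V (edge_selection_law p) \<mu>0 (directed_pawbar \<gamma>opt a \<mu>0)"
    using a p by (intro reaches_consensus) (auto simp: E')
next
  have card: "card V = n" using assms(2) by simp
  fix E p and \<gamma>opt :: "nat set list \<Rightarrow> (real ^ 'd) measure \<Rightarrow> (real ^ 'd) measure \<Rightarrow> ((real ^ 'd) \<times> (real ^ 'd)) measure"
  assume G: "line_graph V E" and p: "set_pmf p = E" and sel: "optimal_plan_selection \<gamma>opt"
  obtain v where v: "bij_betw v {1..n} V" and E: "E = {{v k, v (k + 1)} | k. 1 \<le> k \<and> k < n}"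
    using G unfolding line_graph_def card by blast
  interpret symmetric_line n V v \<gamma>opt \<mu>0
    using assms v sel by unfold_locales auto
  have "E = edge ` {1..<n}" unfolding E edge_def by auto
  then show "reaches_random_consensus V (edge_selection_law p) \<mu>0 (symmetric_pawbar \<gamma>opt \<mu>0)"
    using p by (intro reaches_consensus) simp
qed

end
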